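(* Let $m,n\ge 2$ be integers. Assume $\mathrm{Hom}(C_m,C_n)\neq\emptyset$, and let $X$ be some connected component of $\mathrm{Hom}(C_m,C_n)$. Then $X$ is either a point or is homotopy equivalent to a circle.
   Context: Graphs are finite and undirected (edge sets are symmetric subsets of $V\times V$; loops are allowed). For an integer $n\ge 2$, $C_n$ is the graph with vertex set $\{1,\dots,n\}$, identified with $\mathbb{Z}_n$, and edge set $\{(x,x+1),(x+1,x) : x\in\mathbb{Z}_n\}$. For graphs $G,H$, $\mathrm{Hom}(G,H)$ is the polyhedral complex whose cells are indexed by all functions $\eta:V(G)\to 2^{V(H)}\setminus\{\emptyset\}$ such that whenever $(x,y)\in E(G)$, $\tilde x\in\eta(x)$ and $\tilde y\in\eta(y)$, one has $(\tilde x,\tilde y)\in E(H)$; the cell $\eta$ is the product over $x\in V(G)$ of the simplices with vertex sets $\eta(x)$, and its closure consists of all cells $\tilde\eta$ with $\tilde\eta(x)\subseteq\eta(x)$ for all $x\in V(G)$. Its vertices are the graph homomorphisms $G\to H$.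
   Formalization: For n = 4, "X is a point" is read as "X is homotopy equivalent to a point", since literally it is false there (a component of Hom(C_2,C_4) is a square); for n ≠ 4 the statement is proved literally: X is a single point or homotopy equivalent to a circle. *)

theory Defs
  imports "HOL-Analysis.Analysis" "HOL-Number_Theory.Cong" "Graph_Theory.Pair_Digraph"
begin

(* A graph is a record of vertices and a set of ordered pairs of vertices; the finite undirected
   graphs, with loops allowed, are the instances of the locale pair_pseudo_graph. *)

definition cycle_graph :: "nat \<Rightarrow> nat pair_pre_digraph" where
  "cycle_graph n = \<lparr> pverts = {1..n},
     parcs = {(x, y). x \<in> {1..n} \<and> y \<in> {1..n} \<and> ([y = x + 1] (mod n) \<or> [x = y + 1] (mod n))} \<rparr>"

lemma pair_pseudo_graph_cycle_graph: "pair_pseudo_graph (cycle_graph n)"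
proof -
  have "finite (parcs (cycle_graph n))"
    by (rule finite_subset[of _ "{1..n} \<times> {1..n}"]) (auto simp: cycle_graph_def)
  then show ?thesis
    by unfold_locales
      (auto simp: cycle_graph_def symmetric_def sym_def)
qed

(* Index functions of the cells; they take the value "undefined" outside the vertices of G. *)
definition hom_cells ::
  "'a pair_pre_digraph \<Rightarrow> 'b pair_pre_digraph \<Rightarrow> ('a \<Rightarrow> 'b set) set" where
  "hom_cells G H = {\<eta> \<in> pverts G \<rightarrow>\<^sub>E (Pow (pverts H) - {{}}).
     \<forall>(x, y) \<in> parcs G. \<forall>x' \<in> \<eta> x. \<forall>y' \<in> \<eta> y. (x', y') \<in> parcs H}"

(* The closed simplex with the finite vertex set S, in barycentric coordinates. *)
definition std_simplex_on :: "'b set \<Rightarrow> ('b \<Rightarrow> real) set" where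
  "std_simplex_on S = {t. (\<forall>y. 0 \<le> t y) \<and> (\<forall>y. y \<notin> S \<longrightarrow> t y = 0) \<and> sum t S = 1}"

definition closed_hom_cell :: "'a pair_pre_digraph \<Rightarrow> ('a \<Rightarrow> 'b set) \<Rightarrow> ('a \<Rightarrow> 'b \<Rightarrow> real) set" where
  "closed_hom_cell G \<eta> = (\<Pi>\<^sub>E x \<in> pverts G. std_simplex_on (\<eta> x))"

(* The underlying space of Hom(G,H) for finite graphs G and H.  Points are families of barycentric
   coordinates, topologised as a subspace of the product topology.  There are finitely many closed
   cells, all of them compact, so this is also the weak topology of the complex. *)
definition Hom_complex ::
  "'a pair_pre_digraph \<Rightarrow> 'b pair_pre_digraph \<Rightarrow> ('a \<Rightarrow> 'b \<Rightarrow> real) set" where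
  "Hom_complex G H = (\<Union>\<eta> \<in> hom_cells G H. closed_hom_cell G \<eta>)"

(* A component of Hom(C_m,C_n) that is a point up to homotopy need not be a single point if n = 4:
   the pair ({1,3}, {2,4}) indexes a square which is a whole component of Hom(C_2,C_4). *)

end

theory Submission
  imports Defs
begin

text \<open>
  Unless \<open>n\<close> is \<open>2\<close> or \<open>4\<close>, the vertices \<open>a - 1\<close> and \<open>a + 1\<close> of \<open>C\<^sub>n\<close> have no common neighbour but \<open>a\<close>, and a
  point of the complex lifts to real heights \<open>u\<^sub>0, \<dots>, u\<^sub>m\<close>, where \<open>x\<close> is sent to the position
  \<open>c + x + 2 u\<^sub>x\<close> on the cycle and non-integral \<open>u\<^sub>x\<close> interpolates between two vertices. Adjacency says
  that each pair \<open>(u\<^sub>x, u\<^sub>x\<^sub>+\<^sub>1)\<close> lies on a monotone staircase in the plane, and closing up says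
  \<open>u\<^sub>m = u\<^sub>0 - q\<close> with \<open>m \<equiv> 2 q (mod n)\<close>. The staircase is a chain for the product order, so the lifts
  with a given \<open>q\<close> are closed under pointwise maxima.

  If \<open>q = 0\<close> or \<open>q = m\<close>, all heights are integers and the corresponding points are isolated. Otherwise there is
  a monotone line of lifts \<open>G\<^sub>s\<close> with \<open>G\<^sub>s\<^sub>+\<^sub>1 = G\<^sub>s + 1\<close>, and \<open>max u G\<^sub>s\<close>, with \<open>s\<close> running from far
  below to far above \<open>u\<^sub>0\<close>, deforms all lifts into this line. The deformation commutes with integer translations,
  hence descends to the complex, where the line becomes a circle. For \<open>n = 4\<close> the components are single
  closed cells; for \<open>n = 2\<close> the complex is finite.
\<close>

section \<open>Quotients by compact fundamental domains\<close>

text \<open>A continuous map from a compact space to a Hausdorff space is closed, hence a quotient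
  map onto its image: the preimage of a closed set under \<open>g\<close> is the
  \<open>q\<close>-image of a compact set.\<close>

lemma continuous_factor_through_compact:
  fixes q :: "'a::topological_space \<Rightarrow> 'b::t2_space" and f :: "'a \<Rightarrow> 'c::topological_space"
  assumes "compact K" "continuous_on K q" "continuous_on K f"
    and eq: "\<And>a b. a \<in> K \<Longrightarrow> b \<in> K \<Longrightarrow> q a = q b \<Longrightarrow> f a = f b"
  shows "\<exists>g. continuous_on (q ` K) g \<and> (\<forall>a\<in>K. g (q a) = f a)"
proof -
  define g where "g y = f (SOME a. a \<in> K \<and> q a = y)" for y
  have g: "g (q a) = f a" if "a \<in> K" for a
  proof -
    have "\<exists>b. b \<in> K \<and> q b = q a" using that by blast
    from someI_ex[OF this] show ?thesis
      unfolding g_def using eq that by blast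
  qed
  have "continuous_on (q ` K) g"
    unfolding continuous_on_closed_invariant
  proof (intro allI impI)
    fix B :: "'c set" assume "closed B"
    from \<open>closed B\<close> obtain C where C: "closed C" "C \<inter> K = f -` B \<inter> K"
      using assms(3) unfolding continuous_on_closed_invariant by blast
    have "compact (C \<inter> K)"
      using assms(1) C(1) by (rule closed_Int_compact[rotated])
    then have "compact (q ` (C \<inter> K))"
      by (rule compact_continuous_image[rotated]) (rule continuous_on_subset[OF assms(2)], blast)
    then have "closed (q ` (C \<inter> K))" by (rule compact_imp_closed)
    moreover have "q ` (C \<inter> K) \<inter> q ` K = g -` B \<inter> q ` K"
      using C(2) g by auto
    ultimately show "\<exists>A. closed A \<and> A \<inter> q ` K = g -` B \<inter> q ` K" by blast
  qed
  with g show ?thesis by blast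
qed

text \<open>The compact set \<open>K\<close> meets every fibre of \<open>p\<close>, so the homotopy
  factors through the compact product \<open>{0..1} \<times> K\<close>; since \<open>H\<close>
  respects the fibres, the resulting formula then holds on all of \<open>Y\<close>.\<close>

lemma homotopic_with_descend:
  fixes p :: "'a::topological_space \<Rightarrow> 'b::t2_space"
  assumes K: "compact K" "K \<subseteq> Y" "p ` K = p ` Y" and p: "continuous_on Y p"
    and H: "continuous_on ({0..1::real} \<times> Y) H"
    and HY: "\<And>t y. t \<in> {0..1} \<Longrightarrow> y \<in> Y \<Longrightarrow> H (t, y) \<in> Y"
    and resp: "\<And>t a b. t \<in> {0..1} \<Longrightarrow> a \<in> Y \<Longrightarrow> b \<in> Y \<Longrightarrow> p a = p b \<Longrightarrow> p (H (t, a)) = p (H (t, b))"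
    and F: "\<And>y. y \<in> Y \<Longrightarrow> F (p y) = p (H (0, y))"
    and G: "\<And>y. y \<in> Y \<Longrightarrow> G (p y) = p (H (1, y))"
  shows "homotopic_with_canon (\<lambda>_. True) (p ` Y) (p ` Y) F G"
proof -
  let ?q = "\<lambda>z::real \<times> 'a. (fst z, p (snd z))"
  have im: "?q ` ({0..1} \<times> K) = {0..1} \<times> p ` Y"
    unfolding K(3)[symmetric] by (auto simp: image_iff)
  have "\<exists>g. continuous_on (?q ` ({0..1} \<times> K)) g \<and> (\<forall>a\<in>{0..1} \<times> K. g (?q a) = p (H a))"
  proof (rule continuous_factor_through_compact)
    show "compact ({0..1::real} \<times> K)" using K by (intro compact_Times) auto
    have "continuous_on ({0..1::real} \<times> K) (\<lambda>z. p (snd z))"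
      using K(2) by (intro continuous_on_compose2[OF p] continuous_intros) auto
    then show "continuous_on ({0..1} \<times> K) ?q"
      by (intro continuous_intros)
    show "continuous_on ({0..1} \<times> K) (\<lambda>a. p (H a))"
    proof (rule continuous_on_compose2[OF p])
      show "continuous_on ({0..1} \<times> K) H" by (rule continuous_on_subset[OF H]) (use K in auto)
    qed (use K HY in auto)
    show "p (H a) = p (H b)" if "a \<in> {0..1} \<times> K" "b \<in> {0..1} \<times> K" "?q a = ?q b" for a b
      using that K(2) resp[of "fst a" "snd a" "snd b"] by (cases a; cases b) auto
  qed
  then obtain g where g: "continuous_on ({0..1} \<times> p ` Y) g"
    and gq: "\<And>t a. t \<in> {0..1} \<Longrightarrow> a \<in> K \<Longrightarrow> g (t, p a) = p (H (t, a))"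
    unfolding im by auto
  have gY: "g (t, p y) = p (H (t, y))" if "t \<in> {0..1}" "y \<in> Y" for t y
  proof -
    have "p y \<in> p ` K" unfolding K(3) using that by simp
    then obtain a where "a \<in> K" "p a = p y" by (auto elim!: imageE)
    then show ?thesis using gq[of t a] resp[of t a y] that K(2) by (metis subset_iff)
  qed
  show ?thesis
  proof (subst homotopic_with, simp, intro exI[of _ g] conjI)
    show "continuous_map (prod_topology (top_of_set {0..1}) (top_of_set (p ` Y))) (top_of_set (p ` Y)) g"
      using g gY HY by (auto simp: prod_topology_subtopology_eu continuous_map_in_subtopology image_subset_iff)
  qed (use F G gY in auto)
qed

text \<open>An equivariant homotopy equivalence between two covering spaces induces one between the
  quotients. Equivariance enters only as compatibility with the fibres of \<open>p\<close> and
  \<open>p'\<close>, so no group action has to be set up.\<close>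

lemma homotopy_eqv_descend:
  fixes p :: "'a::topological_space \<Rightarrow> 'b::t2_space" and p' :: "'c::topological_space \<Rightarrow> 'd::t2_space"
  assumes K: "compact K" "K \<subseteq> Y" "p ` K = p ` Y" and p: "continuous_on Y p"
    and L: "compact L" "L \<subseteq> Z" "p' ` L = p' ` Z" and p': "continuous_on Z p'"
    and f: "continuous_on Y f" "f \<in> Y \<rightarrow> Z" "\<And>a b. a \<in> Y \<Longrightarrow> b \<in> Y \<Longrightarrow> p a = p b \<Longrightarrow> p' (f a) = p' (f b)"
    and g: "continuous_on Z g" "g \<in> Z \<rightarrow> Y" "\<And>a b. a \<in> Z \<Longrightarrow> b \<in> Z \<Longrightarrow> p' a = p' b \<Longrightarrow> p (g a) = p (g b)"
    and H: "continuous_on ({0..1::real} \<times> Y) H"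
      "\<And>t y. t \<in> {0..1} \<Longrightarrow> y \<in> Y \<Longrightarrow> H (t, y) \<in> Y"
      "\<And>t a b. t \<in> {0..1} \<Longrightarrow> a \<in> Y \<Longrightarrow> b \<in> Y \<Longrightarrow> p a = p b \<Longrightarrow> p (H (t, a)) = p (H (t, b))"
      "\<And>y. y \<in> Y \<Longrightarrow> H (0, y) = y" "\<And>y. y \<in> Y \<Longrightarrow> H (1, y) = g (f y)"
    and H': "continuous_on ({0..1::real} \<times> Z) H'"
      "\<And>t y. t \<in> {0..1} \<Longrightarrow> y \<in> Z \<Longrightarrow> H' (t, y) \<in> Z"
      "\<And>t a b. t \<in> {0..1} \<Longrightarrow> a \<in> Z \<Longrightarrow> b \<in> Z \<Longrightarrow> p' a = p' b \<Longrightarrow> p' (H' (t, a)) = p' (H' (t, b))"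
      "\<And>y. y \<in> Z \<Longrightarrow> H' (0, y) = y" "\<And>y. y \<in> Z \<Longrightarrow> H' (1, y) = f (g y)"
  shows "p ` Y homotopy_eqv p' ` Z"
proof -
  have "\<exists>h. continuous_on (p ` K) h \<and> (\<forall>a\<in>K. h (p a) = p' (f a))"
  proof (rule continuous_factor_through_compact[OF K(1)])
    show "continuous_on K p" by (rule continuous_on_subset[OF p K(2)])
    show "continuous_on K (\<lambda>a. p' (f a))"
      by (rule continuous_on_compose2[OF p' continuous_on_subset[OF f(1) K(2)]]) (use f(2) K(2) in blast)
  qed (use f(3) K(2) in blast)
  then obtain F where F: "continuous_on (p ` Y) F" "\<And>a. a \<in> K \<Longrightarrow> F (p a) = p' (f a)"
    using K by auto
  have FY: "F (p y) = p' (f y)" if "y \<in> Y" for y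
  proof -
    have "p y \<in> p ` K" unfolding K(3) using that by simp
    then obtain a where "a \<in> K" "p a = p y" by (auto elim!: imageE)
    then show ?thesis using F(2)[of a] f(3)[of a y] that K(2) by (metis subset_iff)
  qed
  have "\<exists>h. continuous_on (p' ` L) h \<and> (\<forall>a\<in>L. h (p' a) = p (g a))"
  proof (rule continuous_factor_through_compact[OF L(1)])
    show "continuous_on L p'" by (rule continuous_on_subset[OF p' L(2)])
    show "continuous_on L (\<lambda>a. p (g a))"
      by (rule continuous_on_compose2[OF p continuous_on_subset[OF g(1) L(2)]]) (use g(2) L(2) in blast)
  qed (use g(3) L(2) in blast)
  then obtain G where G: "continuous_on (p' ` Z) G" "\<And>a. a \<in> L \<Longrightarrow> G (p' a) = p (g a)"
    using L by auto
  have GZ: "G (p' y) = p (g y)" if "y \<in> Z" for y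
  proof -
    have "p' y \<in> p' ` L" unfolding L(3) using that by simp
    then obtain a where "a \<in> L" "p' a = p' y" by (auto elim!: imageE)
    then show ?thesis using G(2)[of a] g(3)[of a y] that L(2) by (metis subset_iff)
  qed
  have 1: "homotopic_with_canon (\<lambda>_. True) (p ` Y) (p ` Y) id (G \<circ> F)"
  proof (rule homotopic_with_descend[OF K p H(1-3)])
    show "(G \<circ> F) (p y) = p (H (1, y))" if "y \<in> Y" for y
      using f(2) that by (simp add: FY GZ H(5) Pi_iff)
  qed (simp_all add: H(4))
  have 2: "homotopic_with_canon (\<lambda>_. True) (p' ` Z) (p' ` Z) id (F \<circ> G)"
  proof (rule homotopic_with_descend[OF L p' H'(1-3)])
    show "(F \<circ> G) (p' y) = p' (H' (1, y))" if "y \<in> Z" for y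
      using g(2) that by (simp add: FY GZ H'(5) Pi_iff)
  qed (simp_all add: H'(4))
  show ?thesis
    unfolding homotopy_equivalent_space_def
  proof (intro exI[of _ F] exI[of _ G] conjI)
    show "continuous_map (top_of_set (p ` Y)) (top_of_set (p' ` Z)) F"
      using F FY f(2) by auto
    show "continuous_map (top_of_set (p' ` Z)) (top_of_set (p ` Y)) G"
      using G GZ g(2) by auto
  qed (use 1 2 homotopic_with_symD in blast)+
qed

text \<open>Gluing along the integers; both the ramp and the barycentric coordinates below are given
  piecewise in this form.\<close>

lemma continuous_on_floor_frac:
  fixes H :: "int \<Rightarrow> real \<Rightarrow> 'a::topological_space"
  assumes "\<And>j. continuous_on {0..1} (H j)" "\<And>j. H j 1 = H (j + 1) 0"
  shows "continuous_on UNIV (\<lambda>s. H \<lfloor>s\<rfloor> (frac s))"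
proof -
  let ?h = "\<lambda>s. H \<lfloor>s\<rfloor> (frac s)"
  have piece: "continuous_on {of_int j..of_int j + 1} ?h" for j
  proof -
    have "continuous_on {of_int j..of_int j + 1} (\<lambda>s. H j (s - of_int j))"
      by (intro continuous_on_compose2[OF assms(1)] continuous_intros) auto
    moreover have "H j (s - of_int j) = ?h s" if "s \<in> {of_int j..of_int j + 1}" for s
    proof (cases "s = of_int j + 1")
      case True
      then have "\<lfloor>s\<rfloor> = j + 1" "frac s = 0" by (auto simp: frac_def)
      with True assms(2) show ?thesis by simp
    next
      case False
      with that have "\<lfloor>s\<rfloor> = j" by (intro floor_unique) auto
      then show ?thesis by (simp add: frac_def)
    qed
    ultimately show ?thesis by (metis (no_types, lifting) continuous_on_cong)
  qed
  have "isCont ?h s" for s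
  proof -
    \<comment> \<open>Rounding up puts \<open>s\<close> strictly inside the union of two adjacent
      pieces, even when \<open>s\<close> is an integer.\<close>
    define j where "j = \<lceil>s\<rceil> - 1"
    have s: "of_int j < s" "s < of_int j + 2" unfolding j_def by linarith+
    have "continuous_on ({of_int j..of_int j + 1} \<union> {of_int j + 1..of_int j + 2}) ?h"
      using piece[of j] piece[of "j + 1"] by (intro continuous_on_closed_Un) (auto simp: algebra_simps)
    also have "{of_int j..of_int j + 1} \<union> {of_int j + 1..of_int j + 2} = {of_int j..of_int j + (2::real)}"
      by auto
    finally show ?thesis
      using s by (intro continuous_on_interior) (auto simp: interior_atLeastAtMost_real)
  qed
  then show ?thesis by (simp add: continuous_at_imp_continuous_on)
qed

text \<open>The piece \<open>A\<close> meeting \<open>X\<close> and the union of the other pieces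
  are disjoint closed sets, so the connected set \<open>X\<close> cannot reach beyond
  \<open>A\<close>. A finite connected nonempty set is a singleton.\<close>

lemma component_of_closed_pieces:
  fixes \<A> :: "'a::metric_space set set"
  assumes "finite \<A>" "\<And>A. A \<in> \<A> \<Longrightarrow> closed A"
    and disj: "\<And>A B. A \<in> \<A> \<Longrightarrow> B \<in> \<A> \<Longrightarrow> A \<noteq> B \<Longrightarrow> A \<inter> B = {}"
    and X: "X \<in> components (\<Union>\<A>)"
  obtains A where "A \<in> \<A>" "connected A \<Longrightarrow> X = A" "finite A \<Longrightarrow> \<exists>p. X = {p}"
proof -
  have "X \<noteq> {}" "connected X" and sub: "X \<subseteq> \<Union>\<A>"
    using X in_components_nonempty in_components_connected in_components_subset by blast+
  then obtain p A where p: "p \<in> X" "p \<in> A" "A \<in> \<A>" by blast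
  have "closed (\<Union>(\<A> - {A}))" using assms(1,2) by (intro closed_Union) auto
  moreover have "X \<subseteq> A \<union> \<Union>(\<A> - {A})" using sub by blast
  moreover have "A \<inter> \<Union>(\<A> - {A}) \<inter> X = {}" using disj p(3) by blast
  ultimately have "\<Union>(\<A> - {A}) \<inter> X = {}"
    using connected_closedD[OF \<open>connected X\<close>, of A "\<Union>(\<A> - {A})"] assms(2)[OF p(3)] p(1,2) by blast
  then have XA: "X \<subseteq> A" using sub by blast
  show ?thesis
  proof (rule that[OF p(3)])
    assume "connected A"
    then have "A \<subseteq> X" using components_maximal[OF X] p by blast
    with XA show "X = A" by blast
  next
    assume "finite A"
    then have "finite X" using XA finite_subset by blast
    with \<open>connected X\<close> \<open>X \<noteq> {}\<close> show "\<exists>p. X = {p}" using connected_finite_iff_sing by blast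
  qed
qed

lemma homotopy_eqv_real_point:
  fixes X :: "'a::topological_space set"
  assumes "contractible X" "X \<noteq> {}"
  shows "X homotopy_eqv {0::real}"
proof -
  obtain a where a: "homotopic_with_canon (\<lambda>_. True) X X id (\<lambda>_. a)"
    using assms by (auto simp: contractible_def)
  then have aX: "a \<in> X" using assms(2) homotopic_with_imp_subset2[OF a] by auto
  show ?thesis
    unfolding homotopy_equivalent_space_def
  proof (intro exI[of _ "\<lambda>_. 0"] exI[of _ "\<lambda>_. a"] conjI)
    show "homotopic_with_canon (\<lambda>_. True) X X ((\<lambda>_. a) \<circ> (\<lambda>_. 0::real)) id"
      using a by (simp add: o_def homotopic_with_sym)
    show "homotopic_with_canon (\<lambda>_. True) {0} {0} ((\<lambda>_. 0) \<circ> (\<lambda>_. a)) (id::real\<Rightarrow>real)"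
      by (rule homotopic_with_equal) auto
  qed (use aX in auto)
qed

section \<open>Staircase profiles\<close>

text \<open>The positions \<open>c + x + 2 u\<close> and \<open>c + x + 1 + 2 v\<close> differ by
  one iff \<open>v\<close> is \<open>u\<close> or \<open>u - 1\<close>. The integrality clause lets
  at most one of two consecutive points lie strictly between vertices, which leaves the unit grid
  edges joining these lattice points.\<close>

definition stair :: "real \<Rightarrow> real \<Rightarrow> bool" where
  "stair u v \<longleftrightarrow> v \<le> u \<and> u \<le> v + 1 \<and> (u \<in> \<int> \<or> v \<in> \<int>)"

lemma stair_add_int [simp]: "stair (u + of_int k) (v + of_int k) \<longleftrightarrow> stair u v"
  by (simp add: stair_def)

lemma Ints_unit_interval_eq:
  fixes a b :: real
  assumes "a \<in> \<int>" "b \<in> \<int>" "a \<le> b" "b < a + 1"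
  shows "a = b"
  using assms by (elim Ints_cases) auto

text \<open>The staircase is totally ordered by the product order, so the maximum of two of its
  points is one of the two.\<close>

lemma stair_max:
  assumes "stair u v" "stair u' v'"
  shows "stair (max u u') (max v v')"
proof -
  have *: "stair (max u u') (max v v')" if "stair u v" "stair u' v'" "u \<le> u'" for u v u' v'
  proof (cases "v \<le> v'")
    case True
    with that show ?thesis by (simp add: max_def)
  next
    case False
    have "u = u'"
    proof (rule ccontr)
      assume "u \<noteq> u'"
      \<comment> \<open>All four numbers lie in \<open>[v', v' + 1]\<close>, and only
        \<open>v'\<close> and \<open>u'\<close> can be a full unit apart. Each point of the
        staircase has an integral coordinate, and an integer from one point would be distinct from,
        yet less than one away from, an integer from the other.\<close>
      with that False have lt: "v' < v" "v \<le> u" "u < u'" "u' \<le> v' + 1" by (auto simp: stair_def)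
      have "u' \<in> \<int> \<or> v' \<in> \<int>" "u \<in> \<int> \<or> v \<in> \<int>" using that by (auto simp: stair_def)
      then show False
      proof (elim disjE)
        assume "u' \<in> \<int>" "u \<in> \<int>" then show False
          using Ints_unit_interval_eq[of u u'] lt by simp
      next
        assume "u' \<in> \<int>" "v \<in> \<int>" then show False
          using Ints_unit_interval_eq[of v u'] lt by simp
      next
        assume "v' \<in> \<int>" "u \<in> \<int>" then show False
          using Ints_unit_interval_eq[of v' u] lt by simp
      next
        assume "v' \<in> \<int>" "v \<in> \<int>" then show False
          using Ints_unit_interval_eq[of v' v] lt by simp
      qed
    qed
    with that False show ?thesis by (simp add: max_def)
  qed
  show ?thesis
    using *[of u v u' v'] *[of u' v' u v] assms by (cases "u \<le> u'") (simp_all add: max.commute)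
qed

lemma closed_stair: "closed {z. stair (fst z) (snd z)}"
proof -
  have "{z. stair (fst z) (snd z)} =
      {z. snd z \<le> fst z} \<inter> {z. fst z \<le> snd z + 1} \<inter> (fst -` \<int> \<union> snd -` \<int>)"
    by (auto simp: stair_def)
  moreover have "closed (fst -` \<int> :: (real \<times> real) set)" "closed (snd -` \<int> :: (real \<times> real) set)"
    by (intro closed_vimage closed_Ints continuous_intros)+
  ultimately show ?thesis
    by (auto intro!: closed_Int closed_Un closed_Collect_le continuous_intros)
qed

text \<open>Only the coordinates up to \<open>m\<close> matter; the others are pinned to \<open>0\<close>.\<close>
definition profiles :: "nat \<Rightarrow> nat \<Rightarrow> (nat \<Rightarrow> real) set" where
  "profiles m q = {u. (\<forall>x>m. u x = 0) \<and> (\<forall>x<m. stair (u x) (u (Suc x))) \<and> u m = u 0 - real q}"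

definition shift :: "nat \<Rightarrow> int \<Rightarrow> (nat \<Rightarrow> real) \<Rightarrow> nat \<Rightarrow> real" where
  "shift m k u x = (if x \<le> m then u x + of_int k else 0)"

lemma shift_profiles [simp]: "u \<in> profiles m q \<Longrightarrow> shift m k u \<in> profiles m q"
  by (simp add: profiles_def shift_def)

lemma stair_chain_bounds:
  assumes "\<And>x. x < m \<Longrightarrow> stair (u x) (u (Suc x))" "x \<le> m"
  shows "u 0 - real x \<le> u x" "u x \<le> u 0"
proof -
  have "u 0 - real x \<le> u x \<and> u x \<le> u 0" using assms(2)
  proof (induction x)
    case (Suc x)
    then have "stair (u x) (u (Suc x))" using assms(1) by simp
    then have "u x - 1 \<le> u (Suc x)" "u (Suc x) \<le> u x" by (auto simp: stair_def)
    then show ?case using Suc by simp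
  qed simp
  then show "u 0 - real x \<le> u x" "u x \<le> u 0" by auto
qed

lemma profiles_bounds:
  assumes "u \<in> profiles m q" "x \<le> m"
  shows "u 0 - real x \<le> u x" "u x \<le> u 0"
  using stair_chain_bounds[of m u x] assms by (auto simp: profiles_def)

lemma continuous_on_coordinate: "continuous_on S (\<lambda>u. u x :: 'a::topological_space)"
  by (rule continuous_on_product_then_coordinatewise) (rule continuous_on_id)

lemma closed_profiles: "closed (profiles m q)"
proof -
  have "closed {u :: nat \<Rightarrow> real. stair (u x) (u (Suc x))}" for x
  proof -
    have "closed ((\<lambda>u :: nat \<Rightarrow> real. (u x, u (Suc x))) -` {z. stair (fst z) (snd z)})"
      by (intro closed_vimage closed_stair continuous_intros continuous_on_coordinate)
    then show ?thesis by simp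
  qed
  then show ?thesis
    unfolding profiles_def
    by (intro closed_Collect_conj closed_Collect_all closed_Collect_imp closed_Collect_eq
        continuous_intros continuous_on_coordinate) auto
qed

text \<open>A fundamental domain for the translations by multiples of \<open>N\<close>, up to
  overlap in its boundary: both ends are included to make it compact.\<close>

definition period_box :: "nat \<Rightarrow> nat \<Rightarrow> nat \<Rightarrow> (nat \<Rightarrow> real) set" where
  "period_box m q N = {u \<in> profiles m q. 0 \<le> u 0 \<and> u 0 \<le> real N}"

text \<open>Bounding \<open>u 0\<close> bounds every height, because a profile falls by at most
  \<open>m\<close>; Tychonoff's theorem does the rest.\<close>

lemma compact_period_box: "compact (period_box m q N)"
proof -
  let ?B = "\<lambda>x. if x \<le> m then {- real m..real N} else {0}"
  have "compactin (product_topology (\<lambda>_. euclideanreal) UNIV) (PiE UNIV ?B)"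
    by (subst compactin_PiE) auto
  then have "compact (PiE UNIV ?B)"
    by (metis compactin_euclidean_iff euclidean_product_topology)
  moreover have "closed (period_box m q N)"
    unfolding period_box_def
    by (intro closed_Collect_conj closed_Collect_le continuous_intros continuous_on_coordinate)
      (simp add: closed_profiles)
  moreover have "period_box m q N \<subseteq> PiE UNIV ?B"
  proof
    fix u assume u: "u \<in> period_box m q N"
    have "u x \<in> ?B x" for x
    proof (cases "x \<le> m")
      case True
      with u profiles_bounds[of u m q x] show ?thesis by (auto simp: period_box_def)
    next
      case False
      with u show ?thesis by (auto simp: period_box_def profiles_def)
    qed
    then show "u \<in> PiE UNIV ?B" by blast
  qed
  ultimately show ?thesis using compact_Int_closed by (metis inf.absorb_iff2)
qed

lemma shift_into_period_box:
  assumes "u \<in> profiles m q" "N > 0"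
  obtains k where "int N dvd k" "shift m k u \<in> period_box m q N"
proof
  define j where "j = \<lfloor>u 0 / real N\<rfloor>"
  have "of_int j \<le> u 0 / real N" "u 0 / real N \<le> of_int j + 1" unfolding j_def by linarith+
  then have "of_int j * real N \<le> u 0" "u 0 \<le> (of_int j + 1) * real N"
    using assms(2) by (simp_all add: field_simps)
  then show "shift m (- j * int N) u \<in> period_box m q N"
    using assms by (simp add: period_box_def algebra_simps) (simp add: shift_def algebra_simps)
qed simp

text \<open>Each step falls by an amount in \<open>[0, 1]\<close>, so a total fall of
  \<open>0\<close> or \<open>m\<close> forces every step. Then \<open>u 0\<close> and
  \<open>u 1\<close> differ by an integer and one of them is integral, hence both are.\<close>

lemma profiles_extreme_Ints:
  assumes "u \<in> profiles m q" "q = 0 \<or> q = m" "m > 0"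
  shows "u 0 \<in> \<int>" "x \<le> m \<Longrightarrow> u x = (if q = 0 then u 0 else u 0 - real x)"
proof -
  have last: "u m = u 0 - real q" using assms by (simp add: profiles_def)
  \<comment> \<open>The same bounds measured from the end; together with those from the start they
    pin down each height.\<close>
  have final: "u m \<le> u x \<and> u x \<le> u m + real m - real x" if "x \<le> m" for x
    using that
  proof (induction x rule: inc_induct)
    case (step x)
    then have "stair (u x) (u (Suc x))" using assms(1) by (simp add: profiles_def)
    then have "u (Suc x) \<le> u x" "u x \<le> u (Suc x) + 1" by (auto simp: stair_def)
    then show ?case using step by simp
  qed simp
  show *: "u x = (if q = 0 then u 0 else u 0 - real x)" if "x \<le> m" for x
    using final[OF that] profiles_bounds[OF assms(1) that] last assms(2) that by auto
  have "stair (u 0) (u 1)" using assms by (simp add: profiles_def)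
  moreover have "u 1 = (if q = 0 then u 0 else u 0 - 1)" using *[of 1] assms(3) by simp
  ultimately show "u 0 \<in> \<int>" by (auto simp: stair_def split: if_splits)
qed

lemma finite_period_box_extreme:
  assumes "q = 0 \<or> q = m" "m > 0"
  shows "finite (period_box m q N)"
proof (rule finite_imageD)
  show "inj_on (\<lambda>u. u 0) (period_box m q N)"
  proof (rule inj_onI, rule ext)
    fix u v x assume "u \<in> period_box m q N" "v \<in> period_box m q N" "u 0 = v 0"
    then show "u x = v x"
      using profiles_extreme_Ints(2)[OF _ assms, of u x] profiles_extreme_Ints(2)[OF _ assms, of v x]
      by (cases "x \<le> m") (auto simp: period_box_def profiles_def)
  qed
  have "(\<lambda>u. u 0) ` period_box m q N \<subseteq> {x \<in> \<int>. 0 \<le> x \<and> x \<le> real N}"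
    using profiles_extreme_Ints(1)[OF _ assms] by (auto simp: period_box_def)
  moreover have "{x \<in> \<int>. 0 \<le> x \<and> x \<le> real N} \<subseteq> real_of_int ` {0..int N}"
    by (auto elim!: Ints_cases)
  ultimately show "finite ((\<lambda>u. u 0) ` period_box m q N)"
    by (meson finite_atLeastAtMost_int finite_imageI finite_subset)
qed

text \<open>Unlike the identity, \<open>ramp e\<close> is constant on \<open>[j + e, j + 1]\<close>; this slack lets one coordinate of a
  profile rest while a neighbour moves.\<close>
definition ramp :: "real \<Rightarrow> real \<Rightarrow> real" where
  "ramp e s = of_int \<lfloor>s\<rfloor> + min 1 (frac s / e)"

context
  fixes e :: real
  assumes e: "0 < e" "e \<le> 1"
begin

lemma ramp_add_int [simp]: "ramp e (s + of_int k) = ramp e s + of_int k"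
  by (simp add: ramp_def frac_def)

lemma continuous_on_ramp: "continuous_on UNIV (ramp e)"
  unfolding ramp_def[abs_def]
  using e by (intro continuous_on_floor_frac continuous_intros) auto

lemma ramp_bounds: "s \<le> ramp e s" "ramp e s \<le> s + 1"
proof -
  have *: "0 \<le> frac s" "frac s < 1" "of_int \<lfloor>s\<rfloor> = s - frac s"
    using frac_lt_1[of s] by (simp_all add: frac_def)
  have "frac s \<le> frac s / e" using e * by (simp add: pos_le_divide_eq mult_left_le)
  with * have "frac s \<le> min 1 (frac s / e)" "min 1 (frac s / e) \<le> 1" by auto
  with * show "s \<le> ramp e s" "ramp e s \<le> s + 1" unfolding ramp_def by linarith+
qed

lemma ramp_eq:
  assumes "of_int j \<le> s" "s \<le> of_int j + 1"
  shows "ramp e s = of_int j + min 1 ((s - of_int j) / e)"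
proof (cases "s = of_int j + 1")
  case True
  then have "\<lfloor>s\<rfloor> = j + 1" "frac s = 0" by (auto simp: frac_def)
  with True e show ?thesis by (simp add: ramp_def min_def)
next
  case False
  with assms have "\<lfloor>s\<rfloor> = j" by (intro floor_unique) auto
  then show ?thesis by (simp add: ramp_def frac_def)
qed

lemma ramp_flat:
  assumes "of_int j + e \<le> s" "s \<le> of_int j + 1"
  shows "ramp e s = of_int j + 1"
  using ramp_eq[of j s] assms e by (simp add: min_def field_simps)

text \<open>While \<open>s\<close> is in a rising window \<open>[j, j + e]\<close>, the delayed
  argument \<open>s - a\<close> is in the flat window \<open>[j - 1 + e, j]\<close>. Otherwise
  \<open>s\<close> rests at the integral value \<open>j + 1\<close>, and the delayed value may be
  anything in \<open>[j, j + 1]\<close>.\<close>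

lemma stair_ramp:
  assumes "e \<le> a" "a \<le> 1 - e"
  shows "stair (ramp e s) (ramp e (s - a))"
proof -
  define j where "j = \<lfloor>s\<rfloor>"
  have j: "of_int j \<le> s" "s < of_int j + 1" unfolding j_def by linarith+
  show ?thesis
  proof (cases "s \<le> of_int j + e")
    case True
    have "ramp e (s - a) = of_int j"
      using ramp_flat[of "j - 1" "s - a"] True j assms by simp
    moreover have "of_int j \<le> ramp e s" "ramp e s \<le> of_int j + 1"
      using ramp_eq[of j s] j e by (auto simp: min_def)
    ultimately show ?thesis by (auto simp: stair_def)
  next
    case False
    have s: "ramp e s = of_int j + 1" using ramp_flat[of j s] False j by simp
    have "of_int j \<le> ramp e (s - a) \<and> ramp e (s - a) \<le> of_int j + 1"
    proof (cases "s - a \<le> of_int j")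
      case True
      have "of_int (j - 1) + e \<le> s - a" "s - a \<le> of_int (j - 1) + 1"
        using True \<open>\<not> s \<le> of_int j + e\<close> assms e by (simp, linarith)+
      from ramp_flat[OF this] have "ramp e (s - a) = of_int j" by simp
      then show ?thesis by simp
    next
      case False
      then show ?thesis
        using ramp_eq[of j "s - a"] j e assms by (auto simp: min_def)
    qed
    with s show ?thesis by (auto simp: stair_def)
  qed
qed

end

text \<open>A rounded line of slope \<open>- q / m\<close>, moving upwards with \<open>s\<close>.\<close>
definition drift :: "nat \<Rightarrow> nat \<Rightarrow> real \<Rightarrow> nat \<Rightarrow> real" where
  "drift m q s x = (if x \<le> m then ramp (1 / real m) (s - real q / real m * real x) else 0)"

text \<open>Consecutive coordinates lag by \<open>q / m\<close>, and \<open>0 < q < m\<close> keeps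
  this at least \<open>1 / m\<close> away from \<open>0\<close> and \<open>1\<close>; hence the
  slack \<open>1 / m\<close> in the ramp. After \<open>m\<close> steps the lag is the integer
  \<open>q\<close>, which gives the closing condition.\<close>

lemma drift_in_profiles:
  assumes "0 < q" "q < m"
  shows "drift m q s \<in> profiles m q"
proof -
  let ?e = "1 / real m" and ?a = "real q / real m"
  have e: "0 < ?e" "?e \<le> 1" using assms by auto
  have a: "?e \<le> ?a" "?a \<le> 1 - ?e" using assms by (auto simp: field_simps)
  have "stair (drift m q s x) (drift m q s (Suc x))" if "x < m" for x
    using stair_ramp[OF e a, of "s - ?a * real x"] that
    by (simp add: drift_def distrib_left diff_diff_eq add.commute)
  moreover have "drift m q s m = drift m q s 0 - real q"
    using ramp_add_int[OF e, of s "- int q"] assms by (simp add: drift_def)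
  ultimately show ?thesis by (simp add: profiles_def drift_def)
qed

lemma drift_add_int:
  assumes "m > 0"
  shows "drift m q (s + of_int k) = shift m k (drift m q s)"
proof
  fix x
  show "drift m q (s + of_int k) x = shift m k (drift m q s) x"
    using ramp_add_int[of "1 / real m" "s - real q / real m * real x" k] assms
    by (simp add: drift_def shift_def algebra_simps)
qed

lemma drift_bounds:
  assumes "q \<le> m" "x \<le> m" "m > 0"
  shows "s - real m \<le> drift m q s x" "drift m q s x \<le> s + 1"
proof -
  let ?e = "1 / real m" and ?b = "real q / real m * real x"
  have e: "0 < ?e" "?e \<le> 1" using assms by auto
  have "real q / real m \<le> 1" using assms by simp
  then have b: "0 \<le> ?b" "?b \<le> real m"
    using assms mult_mono[of "real q / real m" 1 "real x" "real m"] by auto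
  have D: "drift m q s x = ramp ?e (s - ?b)" using assms(2) by (simp add: drift_def)
  show "s - real m \<le> drift m q s x" "drift m q s x \<le> s + 1"
    using ramp_bounds[OF e, of "s - ?b"] b by (simp_all only: D)
qed

lemma continuous_on_drift:
  assumes "m > 0" "continuous_on S f"
  shows "continuous_on S (\<lambda>z. drift m q (f z) x)"
proof (cases "x \<le> m")
  case True
  have "0 < 1 / real m" "1 / real m \<le> 1" using assms by auto
  from continuous_on_compose2[OF continuous_on_ramp[OF this], of S "\<lambda>z. f z - real q / real m * real x"]
  show ?thesis using True assms(2) by (simp add: drift_def continuous_intros)
qed (simp add: drift_def)

section \<open>Points of the complex and their lifts\<close>

definition cyc_vertex :: "nat \<Rightarrow> int \<Rightarrow> nat" where
  "cyc_vertex n a = nat ((a - 1) mod int n) + 1"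

lemma cyc_vertex_in: "n > 0 \<Longrightarrow> cyc_vertex n a \<in> {1..n}"
  by (simp add: cyc_vertex_def nat_less_iff Suc_le_eq)

lemma int_cyc_vertex: "n > 0 \<Longrightarrow> int (cyc_vertex n a) = (a - 1) mod int n + 1"
  by (simp add: cyc_vertex_def)

lemma cyc_vertex_eq_iff: "n > 0 \<Longrightarrow> cyc_vertex n a = cyc_vertex n b \<longleftrightarrow> int n dvd a - b"
  by (simp add: cyc_vertex_def eq_nat_nat_iff mod_eq_dvd_iff)

lemma cyc_vertex_of_nat: "v \<in> {1..n} \<Longrightarrow> cyc_vertex n (int v) = v"
  unfolding cyc_vertex_def by (subst mod_pos_pos_trivial) auto

lemma cycle_arc_iff:
  assumes "n > 0"
  shows "(cyc_vertex n a, cyc_vertex n b) \<in> parcs (cycle_graph n) \<longleftrightarrow>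
    cyc_vertex n b = cyc_vertex n (a + 1) \<or> cyc_vertex n b = cyc_vertex n (a - 1)"
proof -
  have *: "[cyc_vertex n y = cyc_vertex n x + 1] (mod n) \<longleftrightarrow> int n dvd y - (x + 1)" for x y
  proof -
    have "[cyc_vertex n y = cyc_vertex n x + 1] (mod n) \<longleftrightarrow>
        [int (cyc_vertex n y) = int (cyc_vertex n x) + 1] (mod int n)"
      by (metis cong_int_iff of_nat_1 of_nat_add)
    also have "\<dots> \<longleftrightarrow> [(y - 1) mod int n + 1 = (x - 1) mod int n + 2] (mod int n)"
      using assms by (simp add: int_cyc_vertex algebra_simps)
    also have "\<dots> \<longleftrightarrow> [(y - 1) + 1 = (x - 1) + 2] (mod int n)"
      by (simp add: cong_def mod_simps)
    finally show ?thesis by (simp add: cong_iff_dvd_diff algebra_simps)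
  qed
  have "int n dvd a - (b + 1) \<longleftrightarrow> int n dvd b - (a - 1)"
    using dvd_minus_iff[of "int n" "b - (a - 1)"] by (simp add: algebra_simps)
  then show ?thesis
    using cyc_vertex_in[OF assms] * assms
    by (auto simp: cycle_graph_def cyc_vertex_eq_iff)
qed

lemma cycle_arc_nbr:
  assumes "n > 0" "(cyc_vertex n a, w) \<in> parcs (cycle_graph n) \<or> (w, cyc_vertex n a) \<in> parcs (cycle_graph n)"
  shows "w = cyc_vertex n (a + 1) \<or> w = cyc_vertex n (a - 1)"
proof -
  have "w \<in> {1..n}" using assms(2) by (auto simp: cycle_graph_def)
  then have w: "w = cyc_vertex n (int w)" by (simp add: cyc_vertex_of_nat)
  have "(cyc_vertex n a, w) \<in> parcs (cycle_graph n)"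
    using assms(2) by (auto simp: cycle_graph_def)
  with w show ?thesis using cycle_arc_iff[OF assms(1), of a "int w"] by metis
qed

text \<open>The point at real position \<open>k + 2 * r\<close>, on the segment spanned by two
  vertices at distance two; one unit of \<open>r\<close> traverses one such segment.\<close>

definition coords :: "nat \<Rightarrow> int \<Rightarrow> real \<Rightarrow> nat \<Rightarrow> real" where
  "coords n k r v = (1 - frac r) * of_bool (v = cyc_vertex n (k + 2 * \<lfloor>r\<rfloor>)) +
     frac r * of_bool (v = cyc_vertex n (k + 2 * \<lfloor>r\<rfloor> + 2))"

lemma continuous_on_coords: "continuous_on UNIV (\<lambda>r. coords n k r v)"
  unfolding coords_def
  by (rule continuous_on_floor_frac[where H = "\<lambda>j f. (1 - f) * of_bool (v = cyc_vertex n (k + 2 * j)) +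
     f * of_bool (v = cyc_vertex n (k + 2 * j + 2))"])
    (auto intro!: continuous_intros simp: algebra_simps)

lemma coords_simplex:
  assumes "n > 0"
  shows "coords n k r \<in> std_simplex_on {1..n}"
proof -
  have "0 \<le> frac r" "frac r \<le> 1" using frac_lt_1[of r] by simp_all
  then have "\<forall>v. 0 \<le> coords n k r v" by (simp add: coords_def)
  moreover have "sum (coords n k r) {1..n} = 1"
  proof -
    have "card ({Suc 0..n} \<inter> {cyc_vertex n b}) = 1" for b
      using cyc_vertex_in[OF assms, of b] by (simp add: Int_absorb1)
    then show ?thesis by (simp add: coords_def[abs_def] sum.distrib)
  qed
  ultimately show ?thesis
    using cyc_vertex_in[OF assms] by (auto simp: std_simplex_on_def coords_def)
qed

lemma coords_support:
  assumes "coords n k r v \<noteq> 0"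
  obtains "v = cyc_vertex n (k + 2 * \<lfloor>r\<rfloor>)" | "v = cyc_vertex n (k + 2 * \<lceil>r\<rceil>)"
proof (cases "r \<in> \<int>")
  case True
  with assms that show ?thesis by (auto simp: coords_def frac_eq_0_iff[THEN iffD2] split: if_splits)
next
  case False
  then have "\<lceil>r\<rceil> = \<lfloor>r\<rfloor> + 1" by (simp add: ceiling_altdef) (metis Ints_of_int)
  with assms that show ?thesis by (auto simp: coords_def of_bool_def algebra_simps split: if_splits)
qed

text \<open>The end \<open>f = 1\<close> is included, although \<open>frac\<close> never reaches it,
  so that barycentric coordinates equal to \<open>1\<close> need no separate treatment.\<close>

lemma coords_between:
  assumes "0 \<le> f" "f \<le> 1"
  shows "coords n k (of_int j + f) v =
    (1 - f) * of_bool (v = cyc_vertex n (k + 2 * j)) + f * of_bool (v = cyc_vertex n (k + 2 * j + 2))"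
proof (cases "f = 1")
  case True
  then show ?thesis by (simp add: coords_def frac_def algebra_simps)
next
  case False
  with assms have "\<lfloor>of_int j + f\<rfloor> = j" by (intro floor_unique) auto
  then show ?thesis by (simp add: coords_def frac_def)
qed

lemma coords_add_int: "coords n k (r + of_int d) = coords n (k + 2 * d) r"
  by (simp add: coords_def fun_eq_iff frac_def algebra_simps)

lemma coords_cong:
  assumes "n > 0" "int n dvd k - k'"
  shows "coords n k = coords n k'"
proof -
  have "cyc_vertex n (k + j) = cyc_vertex n (k' + j)" for j
    using assms by (simp add: cyc_vertex_eq_iff)
  from this[of "2 * j" for j] this[of "2 * j + 2" for j] show ?thesis
    by (simp add: coords_def fun_eq_iff add.assoc)
qed

section \<open>Unique lifting of positions\<close>

context
  fixes n :: nat
  assumes n: "n \<ge> 3" "n \<noteq> 4"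
begin

lemma not_dvd_2_4: "\<not> int n dvd 2" "\<not> int n dvd 4"
proof -
  show "\<not> int n dvd 2" using n zdvd_imp_le[of "int n" 2] by auto
  show "\<not> int n dvd 4"
  proof
    assume *: "int n dvd 4"
    then have "int n \<le> 4" by (rule zdvd_imp_le) simp
    with n have "n = 3" by simp
    with * show False by simp
  qed
qed

text \<open>The first gap keeps the two ends of a segment distinct. The second makes
  \<open>a + 1\<close> the only common neighbour of \<open>a\<close> and \<open>a + 2\<close>; this
  is what fails for \<open>n = 4\<close>.\<close>

lemma cyc_vertex_gap:
  "cyc_vertex n (a + 2) \<noteq> cyc_vertex n a" "cyc_vertex n (a + 4) \<noteq> cyc_vertex n a"
  using n not_dvd_2_4 by (simp_all add: cyc_vertex_eq_iff)

lemma coords_eqD: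
  assumes eq: "coords n k r = coords n k' r'"
  shows "\<exists>d. r' = r + of_int d \<and> int n dvd k' + 2 * d - k"
proof -
  have n0: "n > 0" using n by simp
  define a b f g where "a = k + 2 * \<lfloor>r\<rfloor>" "b = k' + 2 * \<lfloor>r'\<rfloor>" "f = frac r" "g = frac r'"
  note defs = this
  have f: "0 \<le> f" "f < 1" "0 \<le> g" "g < 1" unfolding defs by (simp_all add: frac_lt_1)
  have c: "coords n k r v = (1 - f) * of_bool (v = cyc_vertex n a) + f * of_bool (v = cyc_vertex n (a + 2))"
    "coords n k' r' v = (1 - g) * of_bool (v = cyc_vertex n b) + g * of_bool (v = cyc_vertex n (b + 2))" for v
    by (simp_all add: coords_def defs)
  have e: "(1 - f) * of_bool (v = cyc_vertex n a) + f * of_bool (v = cyc_vertex n (a + 2)) =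
      (1 - g) * of_bool (v = cyc_vertex n b) + g * of_bool (v = cyc_vertex n (b + 2))" for v
    using eq c by metis
  \<comment> \<open>The weight \<open>1 - f\<close> of the starting vertex is positive. If the
    starting vertices differed, each would be the far end of the other segment, and adding the two
    congruences would give that \<open>n\<close> divides \<open>4\<close>.\<close>
  have ab: "cyc_vertex n b = cyc_vertex n a"
  proof (rule ccontr)
    assume ne: "cyc_vertex n b \<noteq> cyc_vertex n a"
    from e[of "cyc_vertex n a"] ne f cyc_vertex_gap[of a] have 1: "cyc_vertex n a = cyc_vertex n (b + 2)"
      by (auto split: if_splits simp: of_bool_def)
    from e[of "cyc_vertex n b"] ne f cyc_vertex_gap[of b] have 2: "cyc_vertex n b = cyc_vertex n (a + 2)"
      by (auto split: if_splits simp: of_bool_def)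
    from 1 2 have "int n dvd a - (b + 2)" "int n dvd b - (a + 2)" using n0 by (simp_all add: cyc_vertex_eq_iff)
    then have "int n dvd (a - (b + 2)) + (b - (a + 2))" by (rule dvd_add)
    then have "int n dvd - 4" by simp
    then show False using not_dvd_2_4 by simp
  qed
  have "f = g"
    using e[of "cyc_vertex n a"] ab cyc_vertex_gap[of a] cyc_vertex_gap[of b] by (auto simp: of_bool_def)
  then have "r' = r + of_int (\<lfloor>r'\<rfloor> - \<lfloor>r\<rfloor>)" unfolding defs by (simp add: frac_def)
  moreover have "int n dvd k' + 2 * (\<lfloor>r'\<rfloor> - \<lfloor>r\<rfloor>) - k"
    using ab n0 by (simp add: cyc_vertex_eq_iff defs algebra_simps)
  ultimately show ?thesis by blast
qed

text \<open>The integer \<open>j\<close> is free: it selects the lift of the segment on which the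
  height is to be read off.\<close>

lemma simplex_between:
  assumes t: "t \<in> std_simplex_on {1..n}"
    and supp: "\<And>w. t w \<noteq> 0 \<Longrightarrow> w = cyc_vertex n a \<or> w = cyc_vertex n (a + 2)"
  shows "0 \<le> t (cyc_vertex n (a + 2)) \<and> t (cyc_vertex n (a + 2)) \<le> 1"
    and "t = coords n (a - 2 * j) (of_int j + t (cyc_vertex n (a + 2)))"
proof -
  let ?x = "cyc_vertex n a" and ?y = "cyc_vertex n (a + 2)"
  have ne: "?x \<noteq> ?y" using cyc_vertex_gap(1)[of a] by metis
  have "1 = sum t {1..n}" using t by (simp add: std_simplex_on_def)
  also have "\<dots> = sum t {?x, ?y}"
    using cyc_vertex_in[of n] n supp by (intro sum.mono_neutral_right) auto
  finally have 1: "t ?x = 1 - t ?y" using ne by simp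
  moreover have "0 \<le> t ?x" "0 \<le> t ?y" using t by (simp_all add: std_simplex_on_def)
  ultimately show 2: "0 \<le> t ?y \<and> t ?y \<le> 1" by simp
  show "t = coords n (a - 2 * j) (of_int j + t ?y)"
  proof
    fix v show "t v = coords n (a - 2 * j) (of_int j + t ?y) v"
      using coords_between[of "t ?y" n "a - 2 * j" j v] 1 2 ne supp[of v] by auto
  qed
qed

text \<open>Path lifting, one vertex of the source at a time.\<close>

lemma stair_lift_step:
  assumes t: "t \<in> std_simplex_on {1..n}"
    and adj: "\<And>v w. coords n k r v \<noteq> 0 \<Longrightarrow> t w \<noteq> 0 \<Longrightarrow> (v, w) \<in> parcs (cycle_graph n)"
  shows "\<exists>r'. stair r r' \<and> coords n (k + 1) r' = t"
proof -
  have n0: "n > 0" using n by simp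
  define a f where "a = k + 2 * \<lfloor>r\<rfloor>" "f = frac r"
  have f: "0 \<le> f" "f < 1" unfolding a_f_def by (simp_all add: frac_lt_1)
  have c: "coords n k r v = (1 - f) * of_bool (v = cyc_vertex n a) + f * of_bool (v = cyc_vertex n (a + 2))" for v
    by (simp add: coords_def a_f_def)
  have "coords n k r (cyc_vertex n a) \<noteq> 0" using cyc_vertex_gap(1)[of a] f by (simp add: c)
  from adj[OF this] have w1: "w = cyc_vertex n (a + 1) \<or> w = cyc_vertex n (a - 1)" if "t w \<noteq> 0" for w
    using cycle_arc_nbr[OF n0] that by blast
  \<comment> \<open>Seen from the base \<open>k + 1\<close>, the neighbours \<open>a - 1\<close> and
    \<open>a + 1\<close> have the heights \<open>\<lfloor>r\<rfloor> - 1\<close> and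
    \<open>\<lfloor>r\<rfloor>\<close>.\<close>
  let ?j = "\<lfloor>r\<rfloor> - 1"
  have supp: "w = cyc_vertex n (a - 1) \<or> w = cyc_vertex n (a - 1 + 2)" if "t w \<noteq> 0" for w
    using w1[OF that] by (metis add.commute add_diff_eq diff_add_eq one_add_one add_diff_cancel_left')
  let ?y = "t (cyc_vertex n (a + 1))"
  have y: "0 \<le> ?y" "?y \<le> 1" "t = coords n (k + 1) (of_int ?j + ?y)"
    using simplex_between(1)[OF t supp] simplex_between(2)[OF t supp, of ?j] by (simp_all add: a_f_def algebra_simps)
  \<comment> \<open>For integral \<open>r\<close> every height in \<open>[r - 1, r]\<close> is
    allowed. Otherwise \<open>a + 2\<close> carries weight too, and the unique common neighbour
    \<open>a + 1\<close> takes all of \<open>t\<close>.\<close>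
  have "stair r (of_int ?j + ?y)"
  proof (cases "r \<in> \<int>")
    case True
    then show ?thesis using y by (auto simp: stair_def elim!: Ints_cases)
  next
    case False
    then have "f > 0" using f unfolding a_f_def by simp
    then have "coords n k r (cyc_vertex n (a + 2)) \<noteq> 0" using cyc_vertex_gap(1)[of a] by (simp add: c)
    from adj[OF this] have w2: "w = cyc_vertex n (a + 3) \<or> w = cyc_vertex n (a + 1)" if "t w \<noteq> 0" for w
      using cycle_arc_nbr[OF n0, of "a + 2" w] that by (auto simp: algebra_simps)
    have "t (cyc_vertex n (a - 1)) = 0"
    proof (rule ccontr)
      assume "t (cyc_vertex n (a - 1)) \<noteq> 0"
      from w2[OF this] show False
        using cyc_vertex_gap(2)[of "a - 1"] cyc_vertex_gap(1)[of "a - 1"] by (auto simp: algebra_simps)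
    qed
    moreover have "t (cyc_vertex n (a - 1)) = 1 - ?y"
      using fun_cong[OF y(3), of "cyc_vertex n (a - 1)"] coords_between[OF y(1,2), of n "k + 1" ?j "cyc_vertex n (a - 1)"]
        cyc_vertex_gap(1)[of "a - 1"] by (simp add: a_f_def algebra_simps)
    ultimately have "?y = 1" by simp
    then show ?thesis by (simp add: stair_def)
  qed
  with y(3) show ?thesis by metis
qed

end

text \<open>A point lies in the cell indexed by its own supports, so the cells can be eliminated in
  favour of a condition on nonzero coordinates.\<close>

lemma Hom_complex_iff:
  assumes "finite (pverts H)" "parcs G \<subseteq> pverts G \<times> pverts G"
  shows "P \<in> Hom_complex G H \<longleftrightarrow> P \<in> (\<Pi>\<^sub>E x\<in>pverts G. std_simplex_on (pverts H)) \<and>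
    (\<forall>(x, y)\<in>parcs G. \<forall>v w. P x v \<noteq> 0 \<longrightarrow> P y w \<noteq> 0 \<longrightarrow> (v, w) \<in> parcs H)" (is "_ \<longleftrightarrow> ?R")
proof
  assume "P \<in> Hom_complex G H"
  then obtain \<eta> where \<eta>: "\<eta> \<in> hom_cells G H" and P: "P \<in> closed_hom_cell G \<eta>"
    by (auto simp: Hom_complex_def)
  have sub: "\<eta> x \<subseteq> pverts H" if "x \<in> pverts G" for x
    using \<eta> that by (auto simp: hom_cells_def PiE_def Pi_def)
  have supp: "v \<in> \<eta> x" if "x \<in> pverts G" "P x v \<noteq> 0" for x v
    using P that by (auto simp: closed_hom_cell_def std_simplex_on_def PiE_def Pi_def)
  have "P x \<in> std_simplex_on (pverts H)" if "x \<in> pverts G" for x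
  proof -
    have "P x \<in> std_simplex_on (\<eta> x)" using P that by (auto simp: closed_hom_cell_def)
    moreover have "sum (P x) (pverts H) = sum (P x) (\<eta> x)"
      using sub[OF that] supp[OF that] assms(1) by (intro sum.mono_neutral_right) auto
    ultimately show ?thesis using sub[OF that] by (auto simp: std_simplex_on_def)
  qed
  moreover have "(v, w) \<in> parcs H" if "(x, y) \<in> parcs G" "P x v \<noteq> 0" "P y w \<noteq> 0" for x y v w
  proof -
    have "v \<in> \<eta> x" "w \<in> \<eta> y" using supp that assms(2) by blast+
    with \<eta> that(1) show ?thesis unfolding hom_cells_def by blast
  qed
  ultimately show ?R using P by (auto simp: closed_hom_cell_def PiE_def)
next
  assume R: ?R
  define \<eta> where "\<eta> = (\<lambda>x\<in>pverts G. {v. P x v \<noteq> 0})"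
  have "\<eta> x \<in> Pow (pverts H) - {{}} \<and> P x \<in> std_simplex_on (\<eta> x)" if "x \<in> pverts G" for x
  proof -
    have P: "P x \<in> std_simplex_on (pverts H)" using R that by auto
    then have sub: "{v. P x v \<noteq> 0} \<subseteq> pverts H" by (auto simp: std_simplex_on_def)
    have "sum (P x) {v. P x v \<noteq> 0} = sum (P x) (pverts H)"
      using sub assms(1) by (intro sum.mono_neutral_left) auto
    also have "\<dots> = 1" using P by (simp add: std_simplex_on_def)
    finally have *: "sum (P x) {v. P x v \<noteq> 0} = 1" .
    then have "{v. P x v \<noteq> 0} \<noteq> {}" by (metis sum.empty zero_neq_one)
    with P sub * that show ?thesis by (auto simp: \<eta>_def std_simplex_on_def)
  qed
  then have "P \<in> closed_hom_cell G \<eta>" "\<eta> \<in> hom_cells G H"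
    using R assms(2) by (auto simp: closed_hom_cell_def hom_cells_def \<eta>_def PiE_def)
  then show "P \<in> Hom_complex G H" by (auto simp: Hom_complex_def)
qed

section \<open>Homomorphism complexes between cycles\<close>

abbreviation "HomC m n \<equiv> Hom_complex (cycle_graph m) (cycle_graph n)"

lemma cycle_succ_iff:
  fixes m x y :: nat
  assumes "x \<in> {1..m}" "y \<in> {1..m}"
  shows "[y = x + 1] (mod m) \<longleftrightarrow> y = (if x = m then 1 else x + 1)"
proof -
  have m: "m > 0" using assms by (cases m) auto
  have eq: "[y = z] (mod m) \<longleftrightarrow> y = z" if "z \<in> {1..m}" for z
    using m assms(2) that cyc_vertex_of_nat[of y m] cyc_vertex_of_nat[of z m]
      cyc_vertex_eq_iff[OF m, of "int y" "int z"]
    by (metis cong_iff_dvd_diff cong_int_iff)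
  show ?thesis
  proof (cases "x = m")
    case True
    have "[y = m + 1] (mod m) \<longleftrightarrow> [y = 1] (mod m)" unfolding cong_def by (metis mod_add_self1)
    then show ?thesis using eq[of 1] m True by simp
  next
    case False
    then show ?thesis using eq[of "x + 1"] assms by simp
  qed
qed

text \<open>By symmetry one orientation of each edge suffices. Reading index \<open>0\<close> as the
  vertex \<open>m\<close> unrolls the cycle into a path of \<open>m\<close> steps, the form in which
  profiles are defined.\<close>

lemma HomC_iff:
  assumes "m > 0"
  shows "P \<in> HomC m n \<longleftrightarrow> P \<in> {1..m} \<rightarrow>\<^sub>E std_simplex_on {1..n} \<and>
    (\<forall>x<m. \<forall>v w. P (if x = 0 then m else x) v \<noteq> 0 \<longrightarrow> P (Suc x) w \<noteq> 0 \<longrightarrow> (v, w) \<in> parcs (cycle_graph n))"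
    (is "_ \<longleftrightarrow> ?S \<and> ?T")
proof -
  have sym: "(v, w) \<in> parcs (cycle_graph k) \<Longrightarrow> (w, v) \<in> parcs (cycle_graph k)" for v w k
    by (auto simp: cycle_graph_def)
  have "(\<forall>(x, y)\<in>parcs (cycle_graph m). \<forall>v w. P x v \<noteq> 0 \<longrightarrow> P y w \<noteq> 0 \<longrightarrow> (v, w) \<in> parcs (cycle_graph n)) \<longleftrightarrow> ?T"
    (is "?L \<longleftrightarrow> _")
  proof
    assume L: ?L
    show ?T
    proof (intro allI impI)
      fix x v w assume x: "x < m" "P (if x = 0 then m else x) v \<noteq> 0" "P (Suc x) w \<noteq> 0"
      have "((if x = 0 then m else x), Suc x) \<in> parcs (cycle_graph m)"
        using x(1) cycle_succ_iff[of "if x = 0 then m else x" m "Suc x"] by (auto simp: cycle_graph_def)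
      with L x show "(v, w) \<in> parcs (cycle_graph n)" by blast
    qed
  next
    assume T: ?T
    have *: "(v, w) \<in> parcs (cycle_graph n)"
      if "x \<in> {1..m}" "y \<in> {1..m}" "[y = x + 1] (mod m)" "P x v \<noteq> 0" "P y w \<noteq> 0" for x y v w
    proof -
      have y: "y = (if x = m then 1 else x + 1)" using cycle_succ_iff that by blast
      show ?thesis
        using T[rule_format, of "if x = m then 0 else x" v w] that y assms by (auto split: if_splits)
    qed
    show ?L
      using * sym[of _ _ n] by (auto simp: cycle_graph_def[of m])
  qed
  moreover have "finite (pverts (cycle_graph n))" "parcs (cycle_graph m) \<subseteq> pverts (cycle_graph m) \<times> pverts (cycle_graph m)"
    by (auto simp: cycle_graph_def)
  ultimately show ?thesis
    by (subst Hom_complex_iff) (auto simp: cycle_graph_def[of m] cycle_graph_def[of n])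
qed

text \<open>Since \<open>C\<^sub>m\<close> has the vertices \<open>1, \<dots>, m\<close>, the height \<open>u 0\<close> does not enter; it duplicates \<open>u m\<close>, shifted by
  \<open>q\<close>.\<close>
definition hom_point :: "nat \<Rightarrow> nat \<Rightarrow> int \<Rightarrow> (nat \<Rightarrow> real) \<Rightarrow> nat \<Rightarrow> nat \<Rightarrow> real" where
  "hom_point m n c u = (\<lambda>x\<in>{1..m}. coords n (c + int x) (u x))"

lemma continuous_on_hom_point: "continuous_on S (hom_point m n c)"
proof -
  have "continuous_on S (\<lambda>u. hom_point m n c u x v)" for x v
  proof (cases "x \<in> {1..m}")
    case True
    then show ?thesis
      using continuous_on_compose2[OF continuous_on_coords[of n "c + int x" v] continuous_on_coordinate[of S x]]
      by (simp add: hom_point_def)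
  next
    case False
    then have "(\<lambda>u. hom_point m n c u x v) = (\<lambda>_. undefined v)"
      by (auto simp: hom_point_def)
    then show ?thesis by (metis continuous_on_const)
  qed
  then show ?thesis by (intro continuous_on_coordinatewise_then_product)
qed

lemma hom_point_shift: "hom_point m n c (shift m d u) = hom_point m n (c + 2 * d) u"
proof -
  have "coords n (c + int x) (u x + of_int d) = coords n (c + 2 * d + int x) (u x)" for x
    unfolding coords_add_int by (simp add: add_ac)
  then have "hom_point m n c (shift m d u) x = hom_point m n (c + 2 * d) u x" for x
    by (cases "x \<in> {1..m}") (auto simp: hom_point_def shift_def)
  then show ?thesis by (rule ext)
qed

lemma hom_point_cong:
  assumes "n > 0" "int n dvd c - c'"
  shows "hom_point m n c u = hom_point m n c' u"
proof -
  have "coords n (c + int x) = coords n (c' + int x)" for x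
    using assms by (intro coords_cong) simp_all
  then show ?thesis by (simp add: hom_point_def)
qed

text \<open>Along the path the base advances by \<open>m\<close> and the height falls by
  \<open>q\<close>; the position changes by \<open>m - 2 q\<close>, which vanishes modulo
  \<open>n\<close>.\<close>

lemma hom_point_wrap:
  assumes "n > 0" "m > 0" "int n dvd int m - 2 * int q" "u \<in> profiles m q" "x \<le> m"
  shows "hom_point m n c u (if x = 0 then m else x) = coords n (c + int x) (u x)"
proof (cases "x = 0")
  case True
  have "u m = u 0 + of_int (- int q)" using assms(4) by (simp add: profiles_def)
  then have "coords n (c + int m) (u m) = coords n (c + int m - 2 * int q) (u 0)"
    by (simp only: coords_add_int) simp
  also have "\<dots> = coords n c (u 0)" using coords_cong[OF assms(1), of "c + int m - 2 * int q" c] assms(3) by simp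
  finally show ?thesis using True assms(2) by (simp add: hom_point_def)
qed (use assms(5) in \<open>simp add: hom_point_def\<close>)

lemma hom_point_in_HomC:
  assumes "n > 0" "m > 0" "int n dvd int m - 2 * int q" "u \<in> profiles m q"
  shows "hom_point m n c u \<in> HomC m n"
proof -
  have "(v, w) \<in> parcs (cycle_graph n)"
    if x: "x < m" and v: "coords n (c + int x) (u x) v \<noteq> 0" and w: "coords n (c + int (Suc x)) (u (Suc x)) w \<noteq> 0"
    for x v w
  proof -
    let ?k = "c + int x"
    have st: "stair (u x) (u (Suc x))" using assms(4) x by (simp add: profiles_def)
    obtain i where i: "v = cyc_vertex n (?k + 2 * i)" "i = \<lfloor>u x\<rfloor> \<or> i = \<lceil>u x\<rceil>"
      using coords_support[OF v] by metis
    obtain j where j: "w = cyc_vertex n (?k + 1 + 2 * j)" "j = \<lfloor>u (Suc x)\<rfloor> \<or> j = \<lceil>u (Suc x)\<rceil>"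
      using coords_support[OF w] by (metis add.assoc of_nat_Suc add.commute)
    \<comment> \<open>One of the two heights is an integer and the other is within one of it on the
      prescribed side, so this holds for every choice of rounding.\<close>
    have "j = i \<or> j = i - 1"
      using st i(2) j(2) unfolding stair_def by (auto elim!: Ints_cases) linarith+
    then have "?k + 1 + 2 * j = (?k + 2 * i) + 1 \<or> ?k + 1 + 2 * j = (?k + 2 * i) - 1" by auto
    then show ?thesis unfolding i(1) j(1) cycle_arc_iff[OF assms(1)] by metis
  qed
  moreover have "hom_point m n c u (Suc x) = coords n (c + int (Suc x)) (u (Suc x))" if "x < m" for x
    using that by (simp add: hom_point_def)
  ultimately show ?thesis
    unfolding HomC_iff[OF assms(2)]
    using coords_simplex[OF assms(1)] hom_point_wrap[OF assms]
    by (auto simp: hom_point_def simp del: of_nat_Suc)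
qed

text \<open>Coordinatewise the lifts differ by integers \<open>d x\<close>. These are constant in
  \<open>x\<close>, so the lift is unique up to translation, and \<open>q\<close>, the total fall,
  is an invariant of the point.\<close>

lemma hom_point_eqD:
  assumes n: "n \<ge> 3" "n \<noteq> 4" and m: "m > 0"
    and q: "int n dvd int m - 2 * int q" and q': "int n dvd int m - 2 * int q'"
    and u: "u \<in> profiles m q" and u': "u' \<in> profiles m q'"
    and eq: "hom_point m n c u = hom_point m n c' u'"
  shows "q = q' \<and> (\<exists>d. int n dvd c' + 2 * d - c \<and> u' = shift m d u)"
proof -
  have n0: "n > 0" using n by simp
  have "\<exists>d. u' x = u x + of_int d \<and> int n dvd c' + 2 * d - c" if "x \<le> m" for x
  proof -
    have "coords n (c + int x) (u x) = coords n (c' + int x) (u' x)"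
      using hom_point_wrap[OF n0 m q u that, of c] hom_point_wrap[OF n0 m q' u' that, of c'] eq by simp
    from coords_eqD[OF n this] show ?thesis by (simp add: algebra_simps)
  qed
  then obtain d where d: "\<And>x. x \<le> m \<Longrightarrow> u' x = u x + of_int (d x)"
    "\<And>x. x \<le> m \<Longrightarrow> int n dvd c' + 2 * d x - c" by metis
  \<comment> \<open>Both profiles fall by an amount in \<open>[0, 1]\<close>, so \<open>d\<close>
    changes by at most one; twice the change is divisible by \<open>n\<close>, but \<open>n\<close>
    does not divide \<open>2\<close>.\<close>
  have step: "d (Suc x) = d x" if "x < m" for x
  proof -
    have st: "stair (u x) (u (Suc x))" "stair (u' x) (u' (Suc x))" using u u' that by (simp_all add: profiles_def)
    define e where "e = d (Suc x) - d x"
    have "e \<in> {-1, 0, 1}"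
      using st d(1)[of x] d(1)[of "Suc x"] that by (auto simp: stair_def e_def)
    moreover have "int n dvd (c' + 2 * d (Suc x) - c) - (c' + 2 * d x - c)"
      using d(2)[of x] d(2)[of "Suc x"] that dvd_diff by (metis Suc_leI less_imp_le_nat)
    then have "int n dvd 2 * e" by (simp add: algebra_simps e_def)
    ultimately have "e = 0" using not_dvd_2_4[OF n] by auto
    then show ?thesis by (simp add: e_def)
  qed
  have const: "d x = d 0" if "x \<le> m" for x
    using that by (induction x) (simp_all add: step)
  have "u m = u 0 - real q" "u' m = u' 0 - real q'" using u u' by (simp_all add: profiles_def)
  then have "q = q'" using d(1)[of m] d(1)[of 0] const[of m] by simp
  moreover have "u' = shift m (d 0) u"
  proof
    fix x show "u' x = shift m (d 0) u x"
      using d(1)[of x] const[of x] u u' by (cases "x \<le> m") (simp_all add: shift_def profiles_def)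
  qed
  ultimately show ?thesis using d(2)[of 0] by auto
qed

lemma lift_profile:
  assumes n: "n \<ge> 3" "n \<noteq> 4" and m: "m > 0" and P: "P \<in> HomC m n"
  obtains c q u where "c < n" "q \<le> m" "int n dvd int m - 2 * int q" "u \<in> profiles m q"
    "P = hom_point m n (int c) u"
proof -
  have n0: "n > 0" using n by simp
  define Q where "Q x = P (if x = 0 then m else x)" for x
  have Q: "Q x \<in> std_simplex_on {1..n}" if "x \<le> m" for x
    using P m that unfolding HomC_iff[OF m] Q_def by (auto simp: PiE_def Pi_def)
  have adj: "(v, w) \<in> parcs (cycle_graph n)" if "x < m" "Q x v \<noteq> 0" "Q (Suc x) w \<noteq> 0" for x v w
    using P that unfolding HomC_iff[OF m] Q_def by auto
  \<comment> \<open>A vertex in the support at index \<open>1\<close> confines the support at index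
    \<open>0\<close> to its two neighbours, which provides the initial height.\<close>
  obtain w where w: "Q 1 w \<noteq> 0"
    using Q[of 1] m by (auto simp: std_simplex_on_def) (metis sum.neutral zero_neq_one)
  then have "w \<in> {1..n}" using Q[of 1] m by (auto simp: std_simplex_on_def)
  then have w_eq: "w = cyc_vertex n (int w)" by (simp add: cyc_vertex_of_nat)
  have "v = cyc_vertex n (int w - 1) \<or> v = cyc_vertex n (int w - 1 + 2)" if "Q 0 v \<noteq> 0" for v
    using adj[of 0 v w] cycle_arc_nbr[OF n0, of "int w" v] that w m w_eq
    by (auto simp: algebra_simps)
  from simplex_between(2)[OF n Q[of 0] this, of 0]
  obtain r where r: "Q 0 = coords n (int w - 1) r" by auto
  \<comment> \<open>Reducing the base modulo \<open>n\<close> leaves finitely many bases.\<close>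
  define c where "c = nat ((int w - 1) mod int n)"
  have c: "c < n" "int n dvd (int w - 1) - int c"
    using n0 by (simp_all add: c_def nat_less_iff minus_mod_eq_mult_div)
  have r: "Q 0 = coords n (int c) r" using r coords_cong[OF n0 c(2)] by simp
  have "\<exists>u. (\<forall>x\<le>k. coords n (int c + int x) (u x) = Q x) \<and> (\<forall>x<k. stair (u x) (u (Suc x)))" if "k \<le> m" for k
    using that
  proof (induction k)
    case 0
    show ?case using r by (intro exI[of _ "\<lambda>_. r"]) simp
  next
    case (Suc k)
    then obtain u where u: "\<And>x. x \<le> k \<Longrightarrow> coords n (int c + int x) (u x) = Q x"
      "\<And>x. x < k \<Longrightarrow> stair (u x) (u (Suc x))" by auto
    have "\<exists>r'. stair (u k) r' \<and> coords n (int c + int k + 1) r' = Q (Suc k)"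
      using Suc.prems adj[of k] u(1)[of k] by (intro stair_lift_step[OF n Q]) auto
    then obtain r' where r': "stair (u k) r'" "coords n (int c + int (Suc k)) r' = Q (Suc k)"
      by (auto simp: algebra_simps)
    show ?case
    proof (intro exI[of _ "u(Suc k := r')"] conjI allI impI)
      fix x assume "x \<le> Suc k"
      then show "coords n (int c + int x) ((u(Suc k := r')) x) = Q x"
        using r' u(1)[of x] by (cases "x = Suc k") auto
    next
      fix x assume "x < Suc k"
      then show "stair ((u(Suc k := r')) x) ((u(Suc k := r')) (Suc x))"
        using r' u(2)[of x] by (cases "x = k") auto
    qed
  qed
  from this[OF order.refl] obtain u where u: "\<And>x. x \<le> m \<Longrightarrow> coords n (int c + int x) (u x) = Q x"
    "\<And>x. x < m \<Longrightarrow> stair (u x) (u (Suc x))" by auto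
  have "coords n (int c) (u 0) = coords n (int c + int m) (u m)"
    using u(1)[of 0] u(1)[of m] m by (simp add: Q_def)
  from coords_eqD[OF n this] obtain d where d: "u m = u 0 + of_int d" "int n dvd int m + 2 * d"
    by (auto simp: algebra_simps)
  \<comment> \<open>The total fall lies between \<open>0\<close> and \<open>m\<close>, so it is a
    natural number \<open>q\<close>.\<close>
  have "- int m \<le> d" "d \<le> 0" using stair_chain_bounds[of m u m] u(2) d(1) by auto
  define q where "q = nat (- d)"
  have q: "int q = - d" "q \<le> m" using \<open>d \<le> 0\<close> \<open>- int m \<le> d\<close> by (auto simp: q_def)
  define u' where "u' x = (if x \<le> m then u x else 0)" for x
  show ?thesis
  proof
    show "c < n" "q \<le> m" by fact+
    show "int n dvd int m - 2 * int q" using d(2) q by simp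
    have "real q = - of_int d" using q(1) by (metis of_int_minus of_int_of_nat_eq)
    then show "u' \<in> profiles m q" using u(2) d(1) by (auto simp: profiles_def u'_def)
    show "P = hom_point m n (int c) u'"
    proof
      fix x show "P x = hom_point m n (int c) u' x"
      proof (cases "x \<in> {1..m}")
        case True
        then show ?thesis using u(1)[of x] by (auto simp: hom_point_def u'_def Q_def)
      next
        case False
        then show ?thesis using P unfolding HomC_iff[OF m] hom_point_def
          by (metis PiE_arb restrict_apply)
      qed
    qed
  qed
qed

section \<open>Components of circle type\<close>

text \<open>The offset \<open>m + 1\<close> exceeds the total variation of a profile, so that the drift lies entirely below the
  profile at time \<open>0\<close> and entirely above it at time \<open>1\<close>.\<close>
definition lift_to_drift :: "nat \<Rightarrow> nat \<Rightarrow> real \<times> (nat \<Rightarrow> real) \<Rightarrow> nat \<Rightarrow> real" where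
  "lift_to_drift m q z x = max (snd z x) (drift m q (snd z 0 + (2 * fst z - 1) * (real m + 1)) x)"

lemma continuous_on_lift_to_drift:
  assumes "m > 0"
  shows "continuous_on S (lift_to_drift m q)"
proof -
  have c: "continuous_on S (\<lambda>z :: real \<times> (nat \<Rightarrow> real). snd z y)" for y
    by (rule continuous_on_compose2[OF continuous_on_coordinate[of UNIV y]])
      (auto intro: continuous_on_snd continuous_on_id)
  have "continuous_on S (\<lambda>z. lift_to_drift m q z x)" for x
    unfolding lift_to_drift_def
    by (intro continuous_on_max c continuous_on_drift[OF assms] continuous_intros)
  then show ?thesis by (rule continuous_on_coordinatewise_then_product)
qed

lemma lift_to_drift_in_profiles:
  assumes "0 < q" "q < m" "u \<in> profiles m q"
  shows "lift_to_drift m q (t, u) \<in> profiles m q"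
proof -
  define v where "v = drift m q (u 0 + (2 * t - 1) * (real m + 1))"
  have v: "v \<in> profiles m q" unfolding v_def by (rule drift_in_profiles[OF assms(1,2)])
  have L: "lift_to_drift m q (t, u) x = max (u x) (v x)" for x
    by (simp add: lift_to_drift_def v_def)
  \<comment> \<open>Both profiles fall by the same \<open>q\<close>, so their maximum satisfies the
    closing condition as well.\<close>
  show ?thesis
    using assms(3) v unfolding profiles_def mem_Collect_eq L by (auto intro: stair_max)
qed

lemma lift_to_drift_ends:
  assumes "0 < q" "q < m" "u \<in> profiles m q"
  shows "lift_to_drift m q (0, u) = u" "lift_to_drift m q (1, u) = drift m q (u 0 + (real m + 1))"
proof -
  have *: "drift m q (u 0 - (real m + 1)) x \<le> u x" "u x \<le> drift m q (u 0 + (real m + 1)) x" for x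
  proof -
    have "drift m q (u 0 - (real m + 1)) x \<le> u x \<and> u x \<le> drift m q (u 0 + (real m + 1)) x"
    proof (cases "x \<le> m")
      case True
      then show ?thesis
        using drift_bounds[of q m x "u 0 - (real m + 1)"] drift_bounds[of q m x "u 0 + (real m + 1)"]
          profiles_bounds[OF assms(3) True] assms(1,2) by simp
    qed (use assms(3) in \<open>simp add: profiles_def drift_def\<close>)
    then show "drift m q (u 0 - (real m + 1)) x \<le> u x" "u x \<le> drift m q (u 0 + (real m + 1)) x" by auto
  qed
  have "u 0 + (2 * 0 - 1) * (real m + 1) = u 0 - (real m + 1)"
    "u 0 + (2 * 1 - 1) * (real m + 1) = u 0 + (real m + 1)" by simp_all
  then show "lift_to_drift m q (0, u) = u" "lift_to_drift m q (1, u) = drift m q (u 0 + (real m + 1))"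
    unfolding lift_to_drift_def[abs_def] fst_conv snd_conv
    by (simp_all only: max_absorb1[OF *(1)] max_absorb2[OF *(2)])
qed

text \<open>The drift parameter is measured from \<open>u 0\<close>, so it moves along with the
  profile.\<close>

lemma lift_to_drift_shift:
  assumes "m > 0"
  shows "lift_to_drift m q (t, shift m k u) = shift m k (lift_to_drift m q (t, u))"
proof
  fix x
  define s where "s = u 0 + (2 * t - 1) * (real m + 1)"
  have s: "shift m k u 0 + (2 * t - 1) * (real m + 1) = s + of_int k"
    by (simp add: shift_def s_def)
  have "max (shift m k u x) (drift m q (s + of_int k) x) = shift m k (\<lambda>x. max (u x) (drift m q s x)) x"
    unfolding drift_add_int[OF assms] by (simp add: shift_def max_def)
  then show "lift_to_drift m q (t, shift m k u) x = shift m k (lift_to_drift m q (t, u)) x"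
    unfolding lift_to_drift_def[abs_def] fst_conv snd_conv s by (simp only: s_def)
qed

text \<open>The deformation joins each profile by a path to the connected line of drifts, which all
  these sets share.\<close>

lemma connected_profiles:
  assumes "0 < q" "q < m"
  shows "connected (profiles m q)"
proof -
  let ?D = "range (drift m q)"
  let ?L = "\<lambda>u. (\<lambda>t. lift_to_drift m q (t, u)) ` {0..1}"
  have m: "m > 0" using assms by simp
  have "continuous_on UNIV (drift m q)"
    by (intro continuous_on_coordinatewise_then_product continuous_on_drift[OF m] continuous_on_id)
  then have D: "connected ?D" by (rule connected_continuous_image) simp
  have "profiles m q = \<Union> ((\<lambda>u. ?D \<union> ?L u) ` profiles m q)"
  proof
    show "profiles m q \<subseteq> \<Union> ((\<lambda>u. ?D \<union> ?L u) ` profiles m q)"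
    proof
      fix u assume u: "u \<in> profiles m q"
      have "lift_to_drift m q (0, u) \<in> ?L u" by (intro imageI) simp
      then have "u \<in> ?L u" by (simp only: lift_to_drift_ends(1)[OF assms u])
      with u show "u \<in> \<Union> ((\<lambda>u. ?D \<union> ?L u) ` profiles m q)" by blast
    qed
    show "\<Union> ((\<lambda>u. ?D \<union> ?L u) ` profiles m q) \<subseteq> profiles m q"
      using drift_in_profiles[OF assms] lift_to_drift_in_profiles[OF assms] by auto
  qed
  moreover have "connected (\<Union> ((\<lambda>u. ?D \<union> ?L u) ` profiles m q))"
  proof (rule connected_Union)
    fix C assume "C \<in> (\<lambda>u. ?D \<union> ?L u) ` profiles m q"
    then obtain u where u: "u \<in> profiles m q" "C = ?D \<union> ?L u" by blast
    have "continuous_on {0..1} (\<lambda>t. lift_to_drift m q (t, u))"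
      by (rule continuous_on_compose2[OF continuous_on_lift_to_drift[OF m, of UNIV]])
        (auto intro: continuous_intros)
    then have "connected (?L u)" by (rule connected_continuous_image) simp
    moreover have "lift_to_drift m q (1, u) \<in> ?L u" by (intro imageI) simp
    then have "drift m q (u 0 + (real m + 1)) \<in> ?D \<inter> ?L u"
      unfolding lift_to_drift_ends(2)[OF assms u(1)] by blast
    ultimately show "connected C" unfolding u(2) using D by (intro connected_Un) auto
  next
    have "drift m q 0 \<in> \<Inter> ((\<lambda>u. ?D \<union> ?L u) ` profiles m q)" by blast
    then show "\<Inter> ((\<lambda>u. ?D \<union> ?L u) ` profiles m q) \<noteq> {}" by blast
  qed
  ultimately show ?thesis by simp
qed

section \<open>The circle as a quotient of the line\<close>

lemma cis_scaled_eq_iff: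
  assumes "N > 0"
  shows "cis (2 * pi * a / real N) = cis (2 * pi * b / real N) \<longleftrightarrow> (\<exists>d. int N dvd d \<and> b = a + of_int d)"
proof
  assume "cis (2 * pi * a / real N) = cis (2 * pi * b / real N)"
  then obtain k :: int where "\<i> * of_real (2 * pi * b / real N) = \<i> * of_real (2 * pi * a / real N) + (of_int (2 * k) * pi) * \<i>"
    unfolding cis_conv_exp by (metis exp_eq)
  from arg_cong[OF this, of Im] have "2 * pi * b / real N = 2 * pi * a / real N + 2 * of_int k * pi" by simp
  then have "pi * b = pi * (a + of_int k * real N)" using assms by (simp add: field_simps)
  then have "b = a + of_int k * real N" by simp
  then show "\<exists>d. int N dvd d \<and> b = a + of_int d" by (intro exI[of _ "k * int N"]) simp
next
  assume "\<exists>d. int N dvd d \<and> b = a + of_int d"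
  then obtain d where "int N dvd d" "b = a + of_int d" by blast
  moreover from this(1) obtain k where "d = int N * k" by (rule dvdE)
  ultimately have "b = a + of_int (int N * k)" by simp
  then have "2 * pi * b / real N = 2 * pi * a / real N + 2 * pi * of_int k" using assms by (simp add: field_simps)
  then show "cis (2 * pi * a / real N) = cis (2 * pi * b / real N)"
    by (simp add: cis_mult[symmetric] cis_multiple_2pi)
qed

lemma cis_scaled_image:
  assumes "N > 0"
  shows "(\<lambda>s. cis (2 * pi * s / real N)) ` {0..real N} = sphere 0 1"
    "range (\<lambda>s. cis (2 * pi * s / real N)) = sphere 0 1"
proof -
  let ?p = "\<lambda>s. cis (2 * pi * s / real N)"
  have 1: "range ?p \<subseteq> sphere 0 1" by auto
  have 2: "sphere 0 1 \<subseteq> range ?p"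
  proof
    fix z :: complex assume "z \<in> sphere 0 1"
    then have "norm z = 1" by simp
    then have "z \<noteq> 0" by auto
    with \<open>norm z = 1\<close> have "cis (Arg z) = z" by (simp add: cis_Arg sgn_div_norm)
    then have "?p (real N * Arg z / (2 * pi)) = z" using assms by simp
    then show "z \<in> range ?p" by (metis rangeI)
  qed
  have 3: "?p s \<in> ?p ` {0..real N}" for s
  proof -
    define j where "j = \<lfloor>s / real N\<rfloor>"
    have "of_int j \<le> s / real N" "s / real N \<le> of_int j + 1" unfolding j_def by linarith+
    then have "s - of_int (int N * j) \<in> {0..real N}"
      using assms by (simp add: field_simps)
    moreover have "?p (s - of_int (int N * j)) = ?p s"
      unfolding cis_scaled_eq_iff[OF assms] by (intro exI[of _ "int N * j"]) simp
    ultimately show ?thesis using imageI[of "s - of_int (int N * j)" "{0..real N}" ?p] by simp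
  qed
  show *: "range ?p = sphere 0 1" using 1 2 by (rule subset_antisym)
  have "range ?p \<subseteq> ?p ` {0..real N}" using 3 by (rule image_subsetI)
  moreover have "?p ` {0..real N} \<subseteq> range ?p" by (rule image_mono) simp
  ultimately show "?p ` {0..real N} = sphere 0 1" unfolding *[symmetric] by (rule subset_antisym[rotated])
qed

context
  fixes n m q :: nat and c :: int
  assumes n: "n \<ge> 3" "n \<noteq> 4" and q: "int n dvd int m - 2 * int q" and m: "m > 0"
begin

lemma hom_point_eq_iff:
  assumes "u \<in> profiles m q" "u' \<in> profiles m q"
  shows "hom_point m n c u = hom_point m n c u' \<longleftrightarrow> (\<exists>d. int n dvd 2 * d \<and> u' = shift m d u)"
proof
  assume "hom_point m n c u = hom_point m n c u'"
  from hom_point_eqD[OF n m q q assms this] show "\<exists>d. int n dvd 2 * d \<and> u' = shift m d u" by auto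
next
  assume "\<exists>d. int n dvd 2 * d \<and> u' = shift m d u"
  then obtain d where "int n dvd 2 * d" "u' = shift m d u" by blast
  then show "hom_point m n c u = hom_point m n c u'"
    using hom_point_cong[of n c "c + 2 * d"] n by (simp add: hom_point_shift)
qed

text \<open>A translation by a multiple of \<open>n\<close> moves every position by a multiple of
  \<open>2 n\<close> and so fixes the point of the complex.\<close>

lemma hom_point_period_box: "hom_point m n c ` period_box m q n = hom_point m n c ` profiles m q"
proof
  show "hom_point m n c ` profiles m q \<subseteq> hom_point m n c ` period_box m q n"
  proof
    fix P assume "P \<in> hom_point m n c ` profiles m q"
    then obtain u where u: "u \<in> profiles m q" "P = hom_point m n c u" by blast
    obtain k where k: "int n dvd k" "shift m k u \<in> period_box m q n"
      using shift_into_period_box[OF u(1), of n] n by auto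
    have "hom_point m n c u = hom_point m n c (shift m k u)"
      using hom_point_eq_iff[OF u(1) shift_profiles[OF u(1)], of k] dvd_mult[OF k(1), of 2] by blast
    with k(2) show "P \<in> hom_point m n c ` period_box m q n" unfolding u(2) by simp
  qed
qed (auto simp: period_box_def)

lemma compact_hom_point_image: "compact (hom_point m n c ` profiles m q)"
  unfolding hom_point_period_box[symmetric]
  by (rule compact_continuous_image[OF continuous_on_hom_point compact_period_box])

text \<open>The profiles and the real line are compared by \<open>u \<mapsto> u 0\<close> and the
  drift; both maps commute with integer translations, and both quotients are by the multiples of
  \<open>N\<close>.\<close>

lemma hom_point_image_circle:
  assumes q': "0 < q" "q < m"
  shows "hom_point m n c ` profiles m q homotopy_eqv sphere (0::complex) 1"
proof -
  \<comment> \<open>\<open>shift m d\<close> moves positions by \<open>2 d\<close>, so it fixes the points of the complex iff \<open>N\<close> divides \<open>d\<close>.\<close>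
  define N where "N = (if even n then n div 2 else n)"
  have N: "N > 0" using n by (auto simp: N_def)
  have dvdN: "int n dvd 2 * d \<longleftrightarrow> int N dvd d" for d
  proof (cases "even n")
    case True
    then have "int n = 2 * int N" by (auto simp: N_def)
    then show ?thesis by simp
  next
    case False
    then have "coprime (int n) 2" by simp
    from coprime_dvd_mult_right_iff[OF this] show ?thesis using False by (simp add: N_def)
  qed
  let ?Y = "profiles m q" and ?p = "hom_point m n c" and ?p' = "\<lambda>s. cis (2 * pi * s / real N)"
  let ?C = "real m + 1"
  \<comment> \<open>The offset makes \<open>?g (u 0)\<close> exactly the end of the deformation at
    time \<open>1\<close>.\<close>
  let ?g = "\<lambda>s. drift m q (s + ?C)"
  let ?H = "lift_to_drift m q"
  \<comment> \<open>A straight-line homotopy; it is equivariant because \<open>s\<close> and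
    \<open>?g s 0\<close> increase by the same integer under translation.\<close>
  let ?H' = "\<lambda>(t, s). (1 - t) * s + t * ?g s 0"
  have p: "?p a = ?p b \<longleftrightarrow> (\<exists>d. int N dvd d \<and> b = shift m d a)" if "a \<in> ?Y" "b \<in> ?Y" for a b
    using hom_point_eq_iff[OF that] dvdN by simp
  have p': "?p' a = ?p' b \<longleftrightarrow> (\<exists>d. int N dvd d \<and> b = a + of_int d)" for a b
    by (rule cis_scaled_eq_iff[OF N])
  have g_add: "?g (s + of_int d) = shift m d (?g s)" for s d
    using drift_add_int[OF m, of q "s + ?C" d] by (simp add: algebra_simps)
  have "?p ` ?Y homotopy_eqv range ?p'"
  proof (rule homotopy_eqv_descend[where K = "period_box m q n" and L = "{0..real N}"
        and f = "\<lambda>u. u 0" and g = ?g and H = ?H and H' = ?H'])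
    show "compact (period_box m q n)" by (rule compact_period_box)
    show "period_box m q n \<subseteq> ?Y" by (auto simp: period_box_def)
    show "?p ` period_box m q n = ?p ` ?Y" by (rule hom_point_period_box)
    show "continuous_on ?Y ?p" by (rule continuous_on_hom_point)
    show "?p' ` {0..real N} = range ?p'" using cis_scaled_image[OF N] by simp
    show "continuous_on UNIV ?p'" using N by (intro continuous_intros) auto
    show "continuous_on ?Y (\<lambda>u. u 0)" by (rule continuous_on_coordinate)
    show "?p' (a 0) = ?p' (b 0)" if "a \<in> ?Y" "b \<in> ?Y" "?p a = ?p b" for a b
      using that(3) unfolding p[OF that(1,2)] p' by (auto simp: shift_def)
    show "continuous_on UNIV ?g"
      by (intro continuous_on_coordinatewise_then_product continuous_on_drift m continuous_intros)
    show "?g \<in> UNIV \<rightarrow> ?Y" using drift_in_profiles[OF q'] by simp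
    show "?p (?g a) = ?p (?g b)" if "?p' a = ?p' b" for a b
      using that drift_in_profiles[OF q'] unfolding p' by (subst p) (auto simp: g_add)
    show "continuous_on ({0..1} \<times> ?Y) ?H" by (rule continuous_on_lift_to_drift[OF m])
    show H_in: "?H (t, y) \<in> ?Y" if "y \<in> ?Y" for t y by (rule lift_to_drift_in_profiles[OF q' that])
    show "?p (?H (t, a)) = ?p (?H (t, b))" if "a \<in> ?Y" "b \<in> ?Y" "?p a = ?p b" for t a b
      using that(3) unfolding p[OF that(1,2)] p[OF H_in[OF that(1)] H_in[OF that(2)]]
      by (auto simp: lift_to_drift_shift[OF m])
    show "?H (0, y) = y" "?H (1, y) = ?g (y 0)" if "y \<in> ?Y" for y
      using lift_to_drift_ends[OF q' that] by auto
    show "continuous_on ({0..1} \<times> UNIV) ?H'"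
      unfolding case_prod_beta by (intro continuous_intros continuous_on_drift m)
    show "?p' (?H' (t, a)) = ?p' (?H' (t, b))" if ab: "?p' a = ?p' b" for t a b
    proof -
      obtain d where d: "int N dvd d" "b = a + of_int d" using ab unfolding p' by blast
      have "?H' (t, b) = ?H' (t, a) + of_int d"
        unfolding d(2) case_prod_conv g_add by (simp add: shift_def algebra_simps)
      with d(1) show ?thesis unfolding p' by blast
    qed
  qed auto
  then show ?thesis using cis_scaled_image(2)[OF N] by simp
qed

end

text \<open>The complex is a finite union of compact images of profile spaces, and two of these
  images are either equal or disjoint.\<close>

lemma component_HomC_generic:
  assumes n: "n \<ge> 3" "n \<noteq> 4" and m: "m > 0" and X: "X \<in> components (HomC m n)"
  shows "(\<exists>p. X = {p}) \<or> X homotopy_eqv sphere (0::complex) 1"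
proof -
  have n0: "n > 0" using n by simp
  define I where "I = {(c, q). c < n \<and> q \<le> m \<and> int n dvd int m - 2 * int q}"
  define A where "A = (\<lambda>(c, q). hom_point m n (int c) ` profiles m q)"
  have "finite I" by (rule finite_subset[of _ "{..<n} \<times> {..m}"]) (auto simp: I_def)
  have un: "\<Union> (A ` I) = HomC m n"
  proof
    show "\<Union> (A ` I) \<subseteq> HomC m n"
      using hom_point_in_HomC[OF n0 m] by (auto simp: A_def I_def)
    show "HomC m n \<subseteq> \<Union> (A ` I)"
    proof
      fix P assume "P \<in> HomC m n"
      then obtain c q u where "c < n" "q \<le> m" "int n dvd int m - 2 * int q" "u \<in> profiles m q"
        "P = hom_point m n (int c) u" by (rule lift_profile[OF n m])
      then have "(c, q) \<in> I" "P \<in> A (c, q)" by (auto simp: A_def I_def)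
      then show "P \<in> \<Union> (A ` I)" by blast
    qed
  qed
  \<comment> \<open>A single common point makes \<open>c'\<close> congruent to
    \<open>c - 2 * d\<close> modulo \<open>n\<close> and the values of \<open>q\<close> equal;
    translating by \<open>- d\<close> then carries one family into the other.\<close>
  have sub: "A (c', q') \<subseteq> A (c, q)"
    if i: "(c, q) \<in> I" "(c', q') \<in> I" and ne: "A (c, q) \<inter> A (c', q') \<noteq> {}" for c q c' q'
  proof -
    obtain u u' where u: "u \<in> profiles m q" "u' \<in> profiles m q'"
      and eq: "hom_point m n (int c) u = hom_point m n (int c') u'"
      using ne by (auto simp: A_def)
    have qq: "int n dvd int m - 2 * int q" "int n dvd int m - 2 * int q'" using i by (auto simp: I_def)
    obtain d where d: "q = q'" "int n dvd int c' + 2 * d - int c"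
      using hom_point_eqD[OF n m qq u eq] by blast
    have "hom_point m n (int c') v = hom_point m n (int c) (shift m (- d) v)" for v
      using hom_point_cong[OF n0, of "int c'" "int c - 2 * d"] d(2) by (simp add: hom_point_shift algebra_simps)
    then show ?thesis using d(1) by (auto simp: A_def)
  qed
  obtain B where B: "B \<in> A ` I" "connected B \<Longrightarrow> X = B" "finite B \<Longrightarrow> \<exists>p. X = {p}"
  proof (rule component_of_closed_pieces[of "A ` I" X])
    show "closed B" if "B \<in> A ` I" for B
      using that compact_hom_point_image[OF n _ m] by (auto simp: A_def I_def intro!: compact_imp_closed)
    show "B \<inter> B' = {}" if "B \<in> A ` I" "B' \<in> A ` I" "B \<noteq> B'" for B B'
    proof (rule ccontr)
      assume ne: "B \<inter> B' \<noteq> {}"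
      obtain c q c' q' where cq: "(c, q) \<in> I" "(c', q') \<in> I" "B = A (c, q)" "B' = A (c', q')"
        using \<open>B \<in> A ` I\<close> \<open>B' \<in> A ` I\<close> by fast
      have "B' \<subseteq> B" "B \<subseteq> B'"
        using sub[OF cq(1,2)] sub[OF cq(2,1)] ne cq(3,4) by (simp_all add: Int_commute)
      with \<open>B \<noteq> B'\<close> show False by blast
    qed
  qed (use \<open>finite I\<close> un X in auto)
  then obtain c q where cq: "q \<le> m" "int n dvd int m - 2 * int q" "B = hom_point m n (int c) ` profiles m q"
    by (auto simp: A_def I_def)
  show ?thesis
  proof (cases "q = 0 \<or> q = m")
    case True
    have "finite B"
      unfolding cq(3) hom_point_period_box[OF n cq(2) m, symmetric]
      by (intro finite_imageI finite_period_box_extreme[OF True m])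
    then show ?thesis using B(3) by blast
  next
    case False
    with cq(1) have q': "0 < q" "q < m" by auto
    have "connected B"
      unfolding cq(3) by (intro connected_continuous_image continuous_on_hom_point connected_profiles[OF q'])
    then show ?thesis using B(2) hom_point_image_circle[OF n cq(2) m q'] cq(3) by simp
  qed
qed

section \<open>The exceptional lengths 2 and 4\<close>

lemma contractible_connected:
  fixes S :: "'a::topological_space set"
  assumes "contractible S"
  shows "connected S"
proof -
  have "connected_space (top_of_set S)"
    by (rule contractible_imp_connected_space) (simp add: assms)
  then have "connectedin euclidean S" unfolding connectedin_def by simp
  then show ?thesis by simp
qed

lemma simplex_support_exists:
  assumes "t \<in> std_simplex_on S"
  obtains v where "v \<in> S" "t v \<noteq> 0"
proof -
  have "sum t S \<noteq> 0" using assms by (simp add: std_simplex_on_def)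
  then show ?thesis using that by (meson sum.neutral)
qed

lemma closed_simplex_product: "closed (PiE I (\<lambda>x. std_simplex_on (S x)))"
proof -
  have cont: "continuous_on T (\<lambda>P. P x v)" for T :: "('a \<Rightarrow> 'b \<Rightarrow> real) set" and x v
    using continuous_on_compose2[OF continuous_on_coordinate[of UNIV v] continuous_on_coordinate[of T x]] by simp
  have "closed {P :: 'a \<Rightarrow> 'b \<Rightarrow> real. P x \<in> std_simplex_on (S x)}" for x
    unfolding std_simplex_on_def mem_Collect_eq
    by (intro closed_Collect_conj closed_Collect_all closed_Collect_imp closed_Collect_le closed_Collect_eq
        open_Collect_const continuous_on_sum cont continuous_on_const)
  moreover have "closed {P :: 'a \<Rightarrow> 'b \<Rightarrow> real. P x = undefined}" for x
    unfolding fun_eq_iff by (intro closed_Collect_all closed_Collect_eq cont continuous_on_const)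
  moreover have "PiE I (\<lambda>x. std_simplex_on (S x)) =
      (\<Inter>x\<in>I. {P. P x \<in> std_simplex_on (S x)}) \<inter> (\<Inter>x\<in>-I. {P. P x = undefined})"
    by (auto simp: PiE_def Pi_def extensional_def)
  ultimately show ?thesis by (simp only:) (intro closed_Int closed_INT ballI)
qed

lemma contractible_simplex_product: "contractible (PiE I (\<lambda>x. std_simplex_on (S x)))" (is "contractible ?K")
proof (cases "?K = {}")
  case False
  then obtain A where A: "A \<in> ?K" by blast
  \<comment> \<open>Straight-line contraction to \<open>A\<close>; outside \<open>I\<close> the
    value must remain \<open>undefined\<close> for the result to stay in \<open>PiE\<close>.\<close>
  define h where "h z x v = (if x \<in> I then (1 - fst z) * snd z x v + fst z * A x v else undefined v)"
    for z :: "real \<times> ('a \<Rightarrow> 'b \<Rightarrow> real)" and x v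
  have cont: "continuous_on T (\<lambda>z. snd z x v)" for T :: "(real \<times> ('a \<Rightarrow> 'b \<Rightarrow> real)) set" and x v
    by (rule continuous_on_product_then_coordinatewise, rule continuous_on_product_then_coordinatewise)
      (intro continuous_intros)
  have "continuous_on ({0..1} \<times> ?K) (\<lambda>z. h z x v)" for x v
  proof (cases "x \<in> I")
    case True
    then show ?thesis unfolding h_def by simp (intro continuous_intros cont)
  qed (simp add: h_def)
  then have h: "continuous_on ({0..1} \<times> ?K) h"
    by (intro continuous_on_coordinatewise_then_product)
  have hK: "h (t, P) \<in> ?K" if "t \<in> {0..1}" "P \<in> ?K" for t P
  proof
    fix x assume x: "x \<in> I"
    have "P x \<in> std_simplex_on (S x)" "A x \<in> std_simplex_on (S x)" using that A x by auto
    then show "h (t, P) x \<in> std_simplex_on (S x)"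
      using that(1) x by (auto simp: h_def std_simplex_on_def sum.distrib simp flip: sum_distrib_left)
  qed (auto simp: h_def)
  have ends: "h (0, P) = P" "h (1, P) = A" if "P \<in> ?K" for P
    using that A by (auto simp: h_def fun_eq_iff PiE_def extensional_def)
  have "homotopic_with_canon (\<lambda>_. True) ?K ?K id (\<lambda>_. A)"
  proof (subst homotopic_with, simp, intro exI[of _ h] conjI)
    have "h z \<in> ?K" if "z \<in> {0..1} \<times> ?K" for z
      using hK[of "fst z" "snd z"] that by (metis mem_Times_iff prod.collapse)
    then have "h ` ({0..1} \<times> ?K) \<subseteq> ?K" by (rule image_subsetI)
    then show "continuous_map (prod_topology (top_of_set {0..1}) (top_of_set ?K)) (top_of_set ?K) h"
      using h by (simp only: prod_topology_subtopology_eu continuous_map_in_subtopology) (simp add: image_subset_iff_funcset)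
  qed (use ends in auto)
  then show ?thesis unfolding contractible_def by blast
qed simp

section \<open>The case \<open>n = 2\<close>\<close>

text \<open>Every vertex of the 2-cycle has exactly one neighbour. A vertex in the support at one
  index thus forces the next coordinate to be a unit mass.\<close>

lemma finite_HomC_2:
  assumes m: "m > 0"
  shows "finite (HomC m 2)"
proof (rule finite_subset)
  let ?T = "{\<lambda>v. of_bool (v = w) | w. w \<in> {1..2::nat}} :: (nat \<Rightarrow> real) set"
  have "finite ((\<lambda>w v. of_bool (v = w) :: real) ` {1..2::nat})" by simp
  then have "finite ?T" by (simp add: Setcompr_eq_image)
  then show "finite ({1..m} \<rightarrow>\<^sub>E ?T)" by (simp add: finite_PiE)
  have arc: "w = 3 - v \<and> v \<in> {1..2}" if "(v, w) \<in> parcs (cycle_graph 2)" for v w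
  proof -
    have "v \<in> {1, 2}" "w \<in> {1, 2}" using that by (auto simp: cycle_graph_def)
    then show ?thesis using that by (auto simp: cycle_graph_def cong_def)
  qed
  show "HomC m 2 \<subseteq> {1..m} \<rightarrow>\<^sub>E ?T"
  proof
    fix P assume P: "P \<in> HomC m 2"
    then have S: "P \<in> {1..m} \<rightarrow>\<^sub>E std_simplex_on {1..2}" unfolding HomC_iff[OF m] by blast
    have "P y \<in> ?T" if y: "y \<in> {1..m}" for y
    proof -
      obtain x where x: "y = Suc x" "x < m" using y by (cases y) auto
      have "(if x = 0 then m else x) \<in> {1..m}" using x by auto
      then have "P (if x = 0 then m else x) \<in> std_simplex_on {1..2}" using S by blast
      then obtain v where v: "P (if x = 0 then m else x) v \<noteq> 0" "v \<in> {1..2}" by (rule simplex_support_exists)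
      have supp: "w = 3 - v" if "P y w \<noteq> 0" for w
        using P v that x arc[of v w] unfolding HomC_iff[OF m] by blast
      have Py: "P y \<in> std_simplex_on {1..2}" using S y by blast
      have "1 = sum (P y) {1..2}" using Py by (simp add: std_simplex_on_def)
      also have "\<dots> = sum (P y) {3 - v}"
        using supp v(2) by (intro sum.mono_neutral_right) auto
      finally have "P y (3 - v) = 1" by simp
      then have "P y = (\<lambda>w. of_bool (w = 3 - v))" using supp by (auto simp: fun_eq_iff)
      then show ?thesis using v(2) by auto
    qed
    with S show "P \<in> {1..m} \<rightarrow>\<^sub>E ?T" by (auto simp: PiE_def)
  qed
qed

section \<open>The case \<open>n = 4\<close>\<close>

text \<open>The 4-cycle is the complete bipartite graph on the odd and the even vertices.\<close>

lemma cycle_graph_4_arcs: "(v, w) \<in> parcs (cycle_graph 4) \<longleftrightarrow> v \<in> {1..4} \<and> w \<in> {1..4} \<and> odd (v + w)"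
proof (cases "v \<in> {1..4} \<and> w \<in> {1..4}")
  case True
  then have "v \<in> {1, 2, 3, 4}" "w \<in> {1, 2, 3, 4}" by auto
  then show ?thesis by (auto simp: cycle_graph_def cong_def)
qed (auto simp: cycle_graph_def)

text \<open>For even \<open>m\<close> this is the closed cell whose index function alternates
  between \<open>{1, 3}\<close> and \<open>{2, 4}\<close>; the parity of \<open>c\<close> decides
  which comes first.\<close>

definition parity_cell :: "nat \<Rightarrow> nat \<Rightarrow> (nat \<Rightarrow> nat \<Rightarrow> real) set" where
  "parity_cell m c = (\<Pi>\<^sub>E x\<in>{1..m}. std_simplex_on {v \<in> {1..4}. even (v + x + c)})"

lemma parity_cell_iff:
  "P \<in> parity_cell m c \<longleftrightarrow> P \<in> {1..m} \<rightarrow>\<^sub>E std_simplex_on {1..4} \<and>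
    (\<forall>x\<in>{1..m}. \<forall>v. P x v \<noteq> 0 \<longrightarrow> even (v + x + c))"
proof -
  have "t \<in> std_simplex_on {v \<in> {1..4}. Q v} \<longleftrightarrow> t \<in> std_simplex_on {1..4} \<and> (\<forall>v. t v \<noteq> 0 \<longrightarrow> Q v)"
    for t :: "nat \<Rightarrow> real" and Q
  proof -
    have eq: "sum t {v \<in> {1..4}. Q v} = sum t {1..4}" if "\<forall>v. t v \<noteq> 0 \<longrightarrow> Q v"
      using that by (intro sum.mono_neutral_left) auto
    show ?thesis
    proof
      assume t: "t \<in> std_simplex_on {v \<in> {1..4}. Q v}"
      then have "\<forall>v. t v \<noteq> 0 \<longrightarrow> Q v" by (auto simp: std_simplex_on_def)
      then show "t \<in> std_simplex_on {1..4} \<and> (\<forall>v. t v \<noteq> 0 \<longrightarrow> Q v)"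
        using t eq by (auto simp: std_simplex_on_def)
    next
      assume t: "t \<in> std_simplex_on {1..4} \<and> (\<forall>v. t v \<noteq> 0 \<longrightarrow> Q v)"
      then show "t \<in> std_simplex_on {v \<in> {1..4}. Q v}"
        using eq unfolding std_simplex_on_def by simp blast
    qed
  qed
  then show ?thesis unfolding parity_cell_def PiE_def by (auto simp: Pi_def)
qed

lemma HomC_4:
  assumes m: "m > 0" and ne: "HomC m 4 \<noteq> {}"
  shows "HomC m 4 = parity_cell m 0 \<union> parity_cell m 1"
proof -
  have cover: "even m \<and> (\<exists>c\<in>{0, 1}. P \<in> parity_cell m c)" if P: "P \<in> HomC m 4" for P
  proof -
    define Q where "Q x = P (if x = 0 then m else x)" for x
    have S: "P \<in> {1..m} \<rightarrow>\<^sub>E std_simplex_on {1..4}" using P unfolding HomC_iff[OF m] by blast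
    have QS: "Q x \<in> std_simplex_on {1..4}" if "x \<le> m" for x
      using S m that unfolding Q_def by (auto simp: PiE_def Pi_def)
    have adj: "odd (v + w)" if "x < m" "Q x v \<noteq> 0" "Q (Suc x) w \<noteq> 0" for x v w
      using P that cycle_graph_4_arcs unfolding HomC_iff[OF m] Q_def by auto
    obtain v0 where v0: "Q 0 v0 \<noteq> 0" using QS[of 0] by (auto elim: simplex_support_exists)
    \<comment> \<open>The support at index \<open>0\<close> has one parity because all its vertices
      share a neighbour; from there parity alternates along the path.\<close>
    have par: "even (v + x + v0)" if "x \<le> m" "Q x v \<noteq> 0" for x v
      using that
    proof (induction x arbitrary: v)
      case 0
      obtain w where "Q (Suc 0) w \<noteq> 0" using QS[of "Suc 0"] m by (auto elim: simplex_support_exists)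
      then have "odd (v + w)" "odd (v0 + w)" using adj[of 0] m 0 v0 by auto
      then show ?case by simp
    next
      case (Suc x)
      obtain w where w: "Q x w \<noteq> 0" using QS[of x] Suc.prems by (auto elim: simplex_support_exists)
      then have "odd (w + v)" "even (w + x + v0)" using adj[of x w v] Suc by auto
      then show ?case by presburger
    qed
    \<comment> \<open>Indices \<open>0\<close> and \<open>m\<close> denote the same vertex, so the
      alternation closes up only for even \<open>m\<close>.\<close>
    have "Q m v0 \<noteq> 0" using v0 m by (simp add: Q_def)
    from par[OF order.refl this] have "even m" by presburger
    moreover have "P \<in> parity_cell m (v0 mod 2)"
      unfolding parity_cell_iff using S par by (auto simp: Q_def)
    then have "\<exists>c\<in>{0, 1}. P \<in> parity_cell m c" by (rule bexI) auto
    ultimately show ?thesis by (rule conjI)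
  qed
  \<comment> \<open>Nonemptiness yields that \<open>m\<close> is even; for odd \<open>m\<close> the
    complex is empty while the parity cells are not.\<close>
  obtain P0 where "P0 \<in> HomC m 4" using ne by blast
  from cover[OF this] have "even m" by (rule conjunct1)
  have "P \<in> HomC m 4" if P: "P \<in> parity_cell m c" for P c
  proof -
    have S: "P \<in> {1..m} \<rightarrow>\<^sub>E std_simplex_on {1..4}"
      and par: "\<And>x v. x \<in> {1..m} \<Longrightarrow> P x v \<noteq> 0 \<Longrightarrow> even (v + x + c)"
      using P unfolding parity_cell_iff by blast+
    have rng: "v \<in> {1..4}" if "x \<in> {1..m}" "P x v \<noteq> 0" for x v
    proof -
      have "P x \<in> std_simplex_on {1..4}" using S that(1) by blast
      with that(2) show ?thesis by (auto simp: std_simplex_on_def)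
    qed
    have "(v, w) \<in> parcs (cycle_graph 4)"
      if x: "x < m" and v: "P (if x = 0 then m else x) v \<noteq> 0" and w: "P (Suc x) w \<noteq> 0" for x v w
    proof -
      have in1: "(if x = 0 then m else x) \<in> {1..m}" and in2: "Suc x \<in> {1..m}" using x by auto
      have "even (v + (if x = 0 then m else x) + c)" "even (w + Suc x + c)"
        using par[OF in1 v] par[OF in2 w] by auto
      then have "odd (v + w)" using \<open>even m\<close> by (cases "x = 0") auto
      then show ?thesis using rng[OF in1 v] rng[OF in2 w] cycle_graph_4_arcs by blast
    qed
    with S show ?thesis unfolding HomC_iff[OF m] by blast
  qed
  then show ?thesis using cover by blast
qed

lemma component_HomC_4:
  assumes m: "m > 0" and X: "X \<in> components (HomC m 4)"
  shows "X homotopy_eqv {0::real}"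
proof -
  have X0: "X \<noteq> {}" "X \<subseteq> HomC m 4" using X in_components_nonempty in_components_subset by blast+
  then have H: "\<Union> {parity_cell m 0, parity_cell m 1} = HomC m 4" using HomC_4[OF m] by auto
  have disj: "parity_cell m 0 \<inter> parity_cell m 1 = {}"
  proof (rule ccontr)
    assume "parity_cell m 0 \<inter> parity_cell m 1 \<noteq> {}"
    then obtain P where P: "P \<in> parity_cell m 0" "P \<in> parity_cell m 1" by blast
    have 1: "1 \<in> {1..m}" using m by simp
    then have "P 1 \<in> std_simplex_on {1..4}" using P(1) unfolding parity_cell_iff by blast
    then obtain v where v: "P 1 v \<noteq> 0" by (rule simplex_support_exists)
    then have "even (v + 1 + 0)" "even (v + 1 + 1)" using P 1 unfolding parity_cell_iff by blast+
    then show False by simp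
  qed
  obtain B where B: "B \<in> {parity_cell m 0, parity_cell m 1}" "connected B \<Longrightarrow> X = B"
  proof (rule component_of_closed_pieces[of "{parity_cell m 0, parity_cell m 1}" X])
    show "closed B" if "B \<in> {parity_cell m 0, parity_cell m 1}" for B
      using that closed_simplex_product by (auto simp: parity_cell_def)
  qed (use X disj in \<open>auto simp: H[simplified]\<close>)
  have "contractible B" using B(1) contractible_simplex_product by (auto simp: parity_cell_def)
  then have "contractible X" using B(2) contractible_connected by blast
  then show ?thesis using homotopy_eqv_real_point X0(1) by blast
qed

theorem theorem6p1:
  fixes m n :: nat and X :: "(nat \<Rightarrow> nat \<Rightarrow> real) set"
  assumes "m \<ge> 2" and "n \<ge> 2"
    and "Hom_complex (cycle_graph m) (cycle_graph n) \<noteq> {}"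
    and "X \<in> components (Hom_complex (cycle_graph m) (cycle_graph n))"
  shows "(X homotopy_eqv {0 :: real} \<or> X homotopy_eqv sphere (0 :: complex) 1) \<and>
         (n \<noteq> 4 \<longrightarrow> (\<exists>p. X = {p}) \<or> X homotopy_eqv sphere (0 :: complex) 1)"
proof (cases "n = 4")
  case True
  then show ?thesis using component_HomC_4[of m X] assms by simp
next
  case False
  have m: "m > 0" using assms(1) by simp
  have *: "(\<exists>p. X = {p}) \<or> X homotopy_eqv sphere (0 :: complex) 1"
  proof (cases "n = 2")
    case True
    \<comment> \<open>Taken as a single closed piece, a finite complex has only singleton
      components.\<close>
    have "finite (HomC m n)" using finite_HomC_2[OF m] True by simp
    then show ?thesis
      using component_of_closed_pieces[of "{HomC m n}" X] assms(4) finite_imp_closed by force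
  next
    case False
    then show ?thesis using component_HomC_generic[of n m X] assms \<open>n \<noteq> 4\<close> m by simp
  qed
  moreover have "X homotopy_eqv {0 :: real}" if "X = {p}" for p
    unfolding that by (rule homotopy_eqv_real_point)
      (metis contractible_space_top_of_set contractible_space_subtopology_singleton, simp)
  ultimately show ?thesis by blast
qed

end
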